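(* For a $\mathbb{Z}$-labelled graph $(\hat G,z)$, the following are equivalent: (i) $\mathrm{rd}(\hat G,z)\le2$; (ii) $(\hat G,z)$ has no minor isomorphic to $(K_4,0)$ nor to $(K_3^{\bullet\bullet},w)$ for any simple labelling $w$; (iii) $(\hat G,z)$ is a subgraph of a $\mathbb{Z}$-labelled graph obtained by a sequence of disjoint unions, $1$-sums and balanced $2$-sums of $\mathbb{Z}$-labelled graphs in $\mathcal F$, where $\mathcal F$ consists of all $\mathbb{Z}$-labelled graphs isomorphic either to $(K_3,0)$ or to a $\mathbb{Z}$-labelled graph with at most two vertices.
   Context: A $\mathbb{Z}$-labelled graph $(\hat G,z)$ is a finite directed multigraph $\hat G=(\hat V,\hat E)$ (selfloops allowed) with a simple labelling $z:\hat E\to\mathbb{Z}$ (selfloops have nonzero labels; no two parallel edges with the same direction and label, nor opposite directions and opposite labels); an edge from $i$ to $j$ with label $\gamma$ is $(i,j;\gamma)$. Minor operations: edge inversion (reverse an edge, negate its label); switching at vertex $i$ by $\gamma$ (each non-loop edge $(i,j;\alpha)$ becomes $(i,j;\alpha+\gamma)$, each non-loop edge $(j,i;\alpha)$ becomes $(j,i;\alpha-\gamma)$). Two $\mathbb{Z}$-labelled graphs are isomorphic if after edge inversions and switchings there is a vertex bijection mapping labelled directed edges exactly onto labelled directed edges. Deletion removes an edge or vertex (with incident edges), restricting labels. Contraction of a non-loop edge $e=(i,j;0)$ identifies $i,j$, removes $e$, and deletes selfloops of label $0$ and redundant parallel edges so the labelling stays simple. A minor is, up to isomorphism, the result of a sequence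 of deletions and contractions; a subgraph, of deletions only. Union and sums: if $(\hat G_1,z_1)$, $(\hat G_2,z_2)$ are subgraphs of $(\hat G,z)$ (with restricted labels $z_i=z|_{\hat E_i}$) with $\hat V_1\cup\hat V_2=\hat V$ and $\hat E_1\cup\hat E_2=\hat E$, then $(\hat G,z)$ is their union, and their intersection is the $\mathbb{Z}$-labelled graph on $\hat V_1\cap\hat V_2$ with edges $\hat E_1\cap\hat E_2$ and restricted labelling. The union is a disjoint union if $\hat V_1\cap\hat V_2=\emptyset$, and a $1$-sum if $\hat V_1\cap\hat V_2$ is a single vertex. $(K_k,0)$ is the simple complete graph on $k$ vertices (edges oriented arbitrarily) with all labels $0$. If $z_1\equiv0$ and the intersection equals $(K_k,0)$, the union is the balanced $k$-sum of $(\hat G_1,0)$ and $(\hat G_2,z_2)$. $K_3^{\bullet\bullet}$ is the directed multigraph on $\{1,2,3\}$ with a single edge from $1$ to $2$, two parallel edges between $1$ and $3$, and two parallel edges between $2$ and $3$. The lift graph of $(\hat G,z)$ has vertex set $\hat V\times\mathbb{Z}$ (elements $i+\gamma$), edges $\{i+\gamma,j+\gamma+z(e)\}$ for edges $e=(i,j;z(e))$, $\gamma\in\mathbb{Z}$, with $\mathbb{Z}$ acting by translation. For nonzero $\ell\in\mathbb{R}^d$, an $\ell$-periodic framework in $\mathbb{R}^d$ is a map $p$ from the lift graph's vertices to $\mathbb{R}^d$ with $p(v+1)-p(v)=\ell$; periodic frameworks (possibly in different dimensions) are equivalent if all edge lengths agree and their lattice vectors have equal length. $(\hat G,z)$ is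 $d$-realizable if every periodic framework of its lift graph in any dimension admits an equivalent periodic framework in $\mathbb{R}^d$; $\mathrm{rd}(\hat G,z)$ is the least such nonnegative integer $d$.
   Formalization: In (iii) the sums are taken up to isomorphism at every stage (switchings and edge inversions are allowed between successive sums); without this, two parallel edges ab with labels 0 and 1, each with a balanced triangle attached, satisfy (i) and (ii) but not (iii). *)

theory Defs
  imports "HOL-Analysis.Analysis"
begin

text \<open>
  A triple \<open>(i, j, \<gamma>)\<close> is an edge from \<open>i\<close> to \<open>j\<close> with label \<open>\<gamma>\<close>. Since the labelling of a
  \<open>\<int>\<close>-labelled graph is simple, an edge is determined by its end vertices, direction and label, so a
  set of triples loses nothing compared with a multigraph carrying a labelling function.
\<close>

record 'v zgraph =
  verts :: "'v set"
  edges :: "('v \<times> 'v \<times> int) set"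

text \<open>
  The last condition excludes an edge together with its inverse; for \<open>i = j\<close> and \<open>\<gamma> = 0\<close> it says
  that selfloops have nonzero labels.
\<close>

definition zlabelled :: "'v zgraph \<Rightarrow> bool" where
  "zlabelled G \<longleftrightarrow> finite (verts G) \<and> finite (edges G) \<and>
     (\<forall>i j \<gamma>. (i, j, \<gamma>) \<in> edges G \<longrightarrow>
        i \<in> verts G \<and> j \<in> verts G \<and> (j, i, - \<gamma>) \<notin> edges G)"

inductive inversion :: "'v zgraph \<Rightarrow> 'v zgraph \<Rightarrow> bool" where
  "(i, j, \<gamma>) \<in> edges G \<Longrightarrow>
   inversion G \<lparr>verts = verts G, edges = insert (j, i, - \<gamma>) (edges G - {(i, j, \<gamma>)})\<rparr>"

definition switch_edge :: "'v \<Rightarrow> int \<Rightarrow> 'v \<times> 'v \<times> int \<Rightarrow> 'v \<times> 'v \<times> int" where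
  "switch_edge i \<gamma> = (\<lambda>(a, b, \<alpha>).
     (a, b, if a = b then \<alpha> else if a = i then \<alpha> + \<gamma> else if b = i then \<alpha> - \<gamma> else \<alpha>))"

inductive switching :: "'v zgraph \<Rightarrow> 'v zgraph \<Rightarrow> bool" where
  "i \<in> verts G \<Longrightarrow>
   switching G \<lparr>verts = verts G, edges = switch_edge i \<gamma> ` edges G\<rparr>"

definition isomorphic :: "'v zgraph \<Rightarrow> 'w zgraph \<Rightarrow> bool" where
  "isomorphic G H \<longleftrightarrow>
     (\<exists>G' f. (sup inversion switching)\<^sup>*\<^sup>* G G' \<and> bij_betw f (verts G') (verts H) \<and>
        edges H = (\<lambda>(i, j, \<gamma>). (f i, f j, \<gamma>)) ` edges G')"

inductive deletion :: "'v zgraph \<Rightarrow> 'v zgraph \<Rightarrow> bool" where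
  del_edge: "e \<in> edges G \<Longrightarrow> deletion G \<lparr>verts = verts G, edges = edges G - {e}\<rparr>"
| del_vertex: "v \<in> verts G \<Longrightarrow>
    deletion G \<lparr>verts = verts G - {v}, edges = {(i, j, \<gamma>) \<in> edges G. i \<noteq> v \<and> j \<noteq> v}\<rparr>"

text \<open>
  Contraction of \<open>(i, j, 0)\<close>, the merged vertex being called \<open>i\<close>. \<open>contracted_edges\<close> are the edges
  before the removal of redundant parallel edges. Equal triples coincide automatically; of a
  remaining pair of mutually inverse edges either one may be kept.
\<close>

definition contracted_edges :: "'v \<Rightarrow> 'v \<Rightarrow> ('v \<times> 'v \<times> int) set \<Rightarrow> ('v \<times> 'v \<times> int) set" where
  "contracted_edges i j E =
     (\<lambda>(a, b, \<alpha>). (if a = j then i else a, if b = j then i else b, \<alpha>)) ` (E - {(i, j, 0)})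
     - {(a, a, 0) |a. True}"

inductive contraction :: "'v zgraph \<Rightarrow> 'v zgraph \<Rightarrow> bool" where
  "\<lbrakk>(i, j, 0) \<in> edges G; i \<noteq> j;
    zlabelled H; verts H = verts G - {j};
    edges H \<subseteq> contracted_edges i j (edges G);
    \<And>a b \<alpha>. (a, b, \<alpha>) \<in> contracted_edges i j (edges G) \<Longrightarrow>
       (a, b, \<alpha>) \<in> edges H \<or> (b, a, - \<alpha>) \<in> edges H\<rbrakk>
   \<Longrightarrow> contraction G H"

definition subgraph_of :: "'w zgraph \<Rightarrow> 'v zgraph \<Rightarrow> bool" where
  "subgraph_of H G \<longleftrightarrow> (\<exists>G'. deletion\<^sup>*\<^sup>* G G' \<and> isomorphic G' H)"

text \<open>
  Only edges with label \<open>0\<close> can be contracted, so inversions and switchings are allowed between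
  deletions and contractions.
\<close>

definition minor_of :: "'w zgraph \<Rightarrow> 'v zgraph \<Rightarrow> bool" where
  "minor_of H G \<longleftrightarrow>
     (\<exists>G'. (\<lambda>A B. inversion A B \<or> switching A B \<or> deletion A B \<or> contraction A B)\<^sup>*\<^sup>* G G' \<and>
        isomorphic G' H)"

text \<open>The graphs \<open>(K\<^sub>k, 0)\<close>, with arbitrary vertex names and orientations.\<close>

definition is_K0 :: "nat \<Rightarrow> 'v zgraph \<Rightarrow> bool" where
  "is_K0 k G \<longleftrightarrow> zlabelled G \<and> card (verts G) = k \<and>
     (\<forall>(i, j, \<gamma>) \<in> edges G. \<gamma> = 0) \<and>
     (\<forall>i \<in> verts G. \<forall>j \<in> verts G. i \<noteq> j \<longrightarrow> (i, j, 0) \<in> edges G \<or> (j, i, 0) \<in> edges G)"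

text \<open>
  The graphs \<open>(K\<^sub>3\<^sup>\<bullet>\<^sup>\<bullet>, w)\<close>. The orientations of the parallel edges are immaterial up to edge
  inversion. Simplicity of \<open>w\<close> amounts to the two inequalities, without which the parallel edges
  would collapse in the set of triples.
\<close>

definition is_K3dd :: "nat zgraph \<Rightarrow> bool" where
  "is_K3dd G \<longleftrightarrow> (\<exists>a b b' c c'. b \<noteq> b' \<and> c \<noteq> c' \<and>
     G = \<lparr>verts = {1, 2, 3},
          edges = {(1, 2, a), (1, 3, b), (1, 3, b'), (2, 3, c), (2, 3, c')}\<rparr>)"

definition zunion :: "'v zgraph \<Rightarrow> 'v zgraph \<Rightarrow> 'v zgraph" where
  "zunion G H = \<lparr>verts = verts G \<union> verts H, edges = edges G \<union> edges H\<rparr>"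

definition zinter :: "'v zgraph \<Rightarrow> 'v zgraph \<Rightarrow> 'v zgraph" where
  "zinter G H = \<lparr>verts = verts G \<inter> verts H, edges = edges G \<inter> edges H\<rparr>"

definition is_union :: "'v zgraph \<Rightarrow> 'v zgraph \<Rightarrow> 'v zgraph \<Rightarrow> bool" where
  "is_union G G1 G2 \<longleftrightarrow>
     zlabelled G \<and> zlabelled G1 \<and> zlabelled G2 \<and> G = zunion G1 G2"

definition disjoint_union :: "'v zgraph \<Rightarrow> 'v zgraph \<Rightarrow> 'v zgraph \<Rightarrow> bool" where
  "disjoint_union G G1 G2 \<longleftrightarrow> is_union G G1 G2 \<and> verts G1 \<inter> verts G2 = {}"

definition one_sum :: "'v zgraph \<Rightarrow> 'v zgraph \<Rightarrow> 'v zgraph \<Rightarrow> bool" where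
  "one_sum G G1 G2 \<longleftrightarrow> is_union G G1 G2 \<and> (\<exists>v. verts G1 \<inter> verts G2 = {v})"

definition balanced_sum :: "nat \<Rightarrow> 'v zgraph \<Rightarrow> 'v zgraph \<Rightarrow> 'v zgraph \<Rightarrow> bool" where
  "balanced_sum k G G1 G2 \<longleftrightarrow> is_union G G1 G2 \<and>
     (\<forall>(i, j, \<gamma>) \<in> edges G1. \<gamma> = 0) \<and> is_K0 k (zinter G1 G2)"

text \<open>
  Isomorphism classes of finite graphs are all represented on \<open>nat\<close>, so graphs on \<open>nat\<close> suffice as
  targets of isomorphisms.
\<close>

definition in_F :: "'v zgraph \<Rightarrow> bool" where
  "in_F G \<longleftrightarrow> zlabelled G \<and>
     (\<exists>K :: nat zgraph. zlabelled K \<and> (is_K0 3 K \<or> card (verts K) \<le> 2) \<and> isomorphic G K)"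

text \<open>
  The sums are taken up to isomorphism. This matters for balanced sums: attaching zero-labelled
  triangles to two parallel edges with different labels requires a switching in between.
\<close>

inductive sum_of_F :: "'v zgraph \<Rightarrow> bool" where
  base: "in_F G \<Longrightarrow> sum_of_F G"
| iso: "\<lbrakk>sum_of_F G; isomorphic G H\<rbrakk> \<Longrightarrow> sum_of_F H"
| disjoint: "\<lbrakk>sum_of_F G1; sum_of_F G2; disjoint_union G G1 G2\<rbrakk> \<Longrightarrow> sum_of_F G"
| one: "\<lbrakk>sum_of_F G1; sum_of_F G2; one_sum G G1 G2\<rbrakk> \<Longrightarrow> sum_of_F G"
| balanced: "\<lbrakk>sum_of_F G1; sum_of_F G2; balanced_sum 2 G G1 G2\<rbrakk> \<Longrightarrow> sum_of_F G"

text \<open>The vertex \<open>i + \<gamma>\<close> of the lift graph is the pair \<open>(i, \<gamma>)\<close>.\<close>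

definition lift_verts :: "'v zgraph \<Rightarrow> ('v \<times> int) set" where
  "lift_verts G = verts G \<times> UNIV"

definition lift_edges :: "'v zgraph \<Rightarrow> ('v \<times> int) set set" where
  "lift_edges G = {{(i, \<gamma>), (j, \<gamma> + \<alpha>)} |i j \<alpha> \<gamma>. (i, j, \<alpha>) \<in> edges G}"

text \<open>
  The dimension varies inside the statement, so \<open>\<real>\<^sup>d\<close> is \<open>topspace (Euclidean_space d)\<close>, the set of
  all \<open>x :: nat \<Rightarrow> real\<close> with \<open>x k = 0\<close> for \<open>k \<ge> d\<close>.
\<close>

definition periodic_framework ::
  "'v zgraph \<Rightarrow> nat \<Rightarrow> (nat \<Rightarrow> real) \<Rightarrow> ('v \<times> int \<Rightarrow> nat \<Rightarrow> real) \<Rightarrow> bool" where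
  "periodic_framework G d l p \<longleftrightarrow>
     l \<in> topspace (Euclidean_space d) \<and> l \<noteq> (\<lambda>_. 0) \<and>
     (\<forall>v \<in> lift_verts G. p v \<in> topspace (Euclidean_space d)) \<and>
     (\<forall>i \<gamma>. (i, \<gamma>) \<in> lift_verts G \<longrightarrow> (\<lambda>k. p (i, \<gamma> + 1) k - p (i, \<gamma>) k) = l)"

definition equivalent_frameworks ::
  "'v zgraph \<Rightarrow> nat \<Rightarrow> (nat \<Rightarrow> real) \<Rightarrow> ('v \<times> int \<Rightarrow> nat \<Rightarrow> real) \<Rightarrow>
   nat \<Rightarrow> (nat \<Rightarrow> real) \<Rightarrow> ('v \<times> int \<Rightarrow> nat \<Rightarrow> real) \<Rightarrow> bool" where
  "equivalent_frameworks G d l p d' l' p' \<longleftrightarrow>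
     L2_set l {..<d} = L2_set l' {..<d'} \<and>
     (\<forall>u v. {u, v} \<in> lift_edges G \<longrightarrow>
        L2_set (\<lambda>k. p u k - p v k) {..<d} = L2_set (\<lambda>k. p' u k - p' v k) {..<d'})"

definition realizable :: "nat \<Rightarrow> 'v zgraph \<Rightarrow> bool" where
  "realizable d G \<longleftrightarrow>
     (\<forall>n l p. periodic_framework G n l p \<longrightarrow>
        (\<exists>l' p'. periodic_framework G d l' p' \<and> equivalent_frameworks G n l p d l' p'))"

definition rd :: "'v zgraph \<Rightarrow> nat" where
  "rd G = (LEAST d. realizable d G)"

end

theory Submission
  imports Defs
begin

text \<open>
  Being \<open>2\<close>-realizable passes to minors: after contracting an edge, place its two ends at the same
  point. Neither \<open>(K\<^sub>4, 0)\<close> (a regular simplex) nor \<open>K\<^sub>3\<^sup>\<bullet>\<^sup>\<bullet>\<close> is \<open>2\<close>-realizable; in the latter, each double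
  edge fixes the component of an edge vector along the lattice vector and the length of the
  orthogonal component. Graphs in \<open>\<F>\<close> are \<open>2\<close>-realizable and planar realizations can be glued
  along the sums, by a translation or, for a zero-labelled summand, by a rigid motion.

  For the structure theorem, a graph without the forbidden minors is decomposed by induction on the
  number of vertices. Separations of order at most one give disjoint unions and \<open>1\<close>-sums. Otherwise,
  at most one pair of vertices is joined by several edges, since two such pairs contract to
  \<open>K\<^sub>3\<^sup>\<bullet>\<^sup>\<bullet>\<close>. Moreover every labelled \<open>K\<^sub>4\<close> has a forbidden minor, so a Dirac-type argument yields a
  vertex with two neighbours outside that pair. It lies on exactly two edges; contracting one of
  them replaces the vertex by an edge between its neighbours, and the vertex is recovered by a
  balanced \<open>2\<close>-sum with a triangle.
\<close>

section \<open>Relabelling, deletion and contraction\<close>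

text \<open>Edges are directed triples, whereas every property in question ignores direction. Most
  of the work is therefore done on \<open>sym_edges\<close>, which inversion leaves unchanged; an
  orientation is chosen only where a deletion or contraction must find its edge literally. Likewise
  a sequence of switchings is recorded as a single potential.

  Two obstacles shape the induction that builds the sums. Contracting an edge at a vertex with two
  neighbours can create an edge between them that the original graph does not have, and the triangle
  is glued along exactly this edge; hence the construction yields a sum that has the same vertices
  and contains the given edges, not the graph itself. Selfloops could occur at a shared vertex in
  opposite directions in two summands, and the union would then not be simply labelled; they are
  left out and attached at the end as one-vertex summands.\<close>

definition sym_edges :: "'v zgraph \<Rightarrow> ('v \<times> 'v \<times> int) set" where
  "sym_edges G = {(i, j, \<gamma>). (i, j, \<gamma>) \<in> edges G \<or> (j, i, - \<gamma>) \<in> edges G}"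

text \<open>Switching at all vertices at once, by a potential: switchings commute and add up, so a
  sequence of them is one function on the vertices. At a selfloop the two contributions cancel,
  which reproduces the exception in \<open>switch_edge\<close>.\<close>

definition shift :: "('v \<Rightarrow> int) \<Rightarrow> 'v zgraph \<Rightarrow> 'v zgraph" where
  "shift \<phi> G =
     \<lparr>verts = verts G, edges = (\<lambda>(a, b, \<alpha>). (a, b, \<alpha> + \<phi> a - \<phi> b)) ` edges G\<rparr>"

definition rename :: "('v \<Rightarrow> 'w) \<Rightarrow> 'v zgraph \<Rightarrow> 'w zgraph" where
  "rename f G = \<lparr>verts = f ` verts G, edges = (\<lambda>(i, j, \<gamma>). (f i, f j, \<gamma>)) ` edges G\<rparr>"

abbreviation relabelling :: "'v zgraph \<Rightarrow> 'v zgraph \<Rightarrow> bool" where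
  "relabelling \<equiv> sup inversion switching"

abbreviation minor_step :: "'v zgraph \<Rightarrow> 'v zgraph \<Rightarrow> bool" where
  "minor_step \<equiv> \<lambda>A B. inversion A B \<or> switching A B \<or> deletion A B \<or> contraction A B"

lemma zgraph_eta [simp]: "\<lparr>verts = verts G, edges = edges G\<rparr> = G"
  by (cases G) simp

lemma in_sym_edges: "(i, j, \<gamma>) \<in> sym_edges G \<longleftrightarrow> (i, j, \<gamma>) \<in> edges G \<or> (j, i, - \<gamma>) \<in> edges G"
  by (simp add: sym_edges_def)

lemma sym_edges_swap: "(i, j, \<gamma>) \<in> sym_edges G \<longleftrightarrow> (j, i, - \<gamma>) \<in> sym_edges G"
  by (auto simp: in_sym_edges)

lemma zlabelledD:
  assumes "zlabelled G"
  shows "finite (verts G)" "finite (edges G)"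
    "(i, j, \<gamma>) \<in> edges G \<Longrightarrow> i \<in> verts G" "(i, j, \<gamma>) \<in> edges G \<Longrightarrow> j \<in> verts G"
    "(i, j, \<gamma>) \<in> edges G \<Longrightarrow> (j, i, - \<gamma>) \<notin> edges G"
  using assms by (auto simp: zlabelled_def)

lemma sym_edges_verts:
  assumes "zlabelled G" "(i, j, \<gamma>) \<in> sym_edges G"
  shows "i \<in> verts G" "j \<in> verts G"
  using assms by (auto simp: in_sym_edges dest: zlabelledD)

lemma sym_edges_loop:
  assumes "zlabelled G" "(i, i, \<gamma>) \<in> sym_edges G"
  shows "\<gamma> \<noteq> 0"
  using assms zlabelledD(5)[OF assms(1), of i i 0] by (auto simp: in_sym_edges)

lemma finite_sym_edges:
  assumes "zlabelled G"
  shows "finite (sym_edges G)"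
proof (rule finite_subset)
  show "sym_edges G \<subseteq> edges G \<union> (\<lambda>(i, j, \<gamma>). (j, i, - \<gamma>)) ` edges G"
    by (force simp: sym_edges_def image_iff)
qed (use zlabelledD(2)[OF assms] in auto)

lemma zlabelled_inversion:
  assumes "zlabelled G" "inversion G H"
  shows "zlabelled H"
  using assms(2)
proof cases
  case (1 i j \<gamma>)
  have "(b, a, - \<alpha>) \<notin> edges H" if "(a, b, \<alpha>) \<in> edges H" for a b \<alpha>
  proof
    assume "(b, a, - \<alpha>) \<in> edges H"
    then have "(b, a, - \<alpha>) \<in> edges G \<or> (a, b, \<alpha>) = (i, j, \<gamma>)"
      using 1(1) by auto
    moreover have "(a, b, \<alpha>) \<in> edges G \<or> (b, a, - \<alpha>) = (i, j, \<gamma>)"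
      using that 1(1) by auto
    moreover have "(i, j, \<gamma>) \<notin> edges H"
      using 1 zlabelledD(5)[OF assms(1) 1(2)] by auto
    ultimately show False
      using that \<open>(b, a, - \<alpha>) \<in> edges H\<close> zlabelledD(5)[OF assms(1)] by metis
  qed
  moreover have "a \<in> verts H \<and> b \<in> verts H" if "(a, b, \<alpha>) \<in> edges H" for a b \<alpha>
    using that 1 zlabelledD(3,4)[OF assms(1)] by auto
  moreover have "finite (verts H)" "finite (edges H)"
    using 1(1) zlabelledD(1,2)[OF assms(1)] by auto
  ultimately show ?thesis unfolding zlabelled_def by blast
qed

lemma sym_edges_inversion:
  assumes "inversion G H"
  shows "sym_edges H = sym_edges G" "verts H = verts G"
  using assms by (cases, force simp: sym_edges_def)+

lemma verts_shift [simp]: "verts (shift \<phi> G) = verts G"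
  by (simp add: shift_def)

lemma in_edges_shift: "(i, j, \<gamma>) \<in> edges (shift \<phi> G) \<longleftrightarrow> (i, j, \<gamma> - \<phi> i + \<phi> j) \<in> edges G"
  by (force simp: shift_def image_iff)

lemma in_sym_shift: "(i, j, \<gamma>) \<in> sym_edges (shift \<phi> G) \<longleftrightarrow> (i, j, \<gamma> - \<phi> i + \<phi> j) \<in> sym_edges G"
  by (simp add: in_sym_edges in_edges_shift algebra_simps)

lemma zlabelled_shift:
  assumes "zlabelled G"
  shows "zlabelled (shift \<phi> G)"
proof -
  have "(j, i, - \<gamma>) \<notin> edges (shift \<phi> G)" if "(i, j, \<gamma>) \<in> edges (shift \<phi> G)" for i j \<gamma>
    using that zlabelledD(5)[OF assms, of i j "\<gamma> - \<phi> i + \<phi> j"]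
    by (auto simp: in_edges_shift algebra_simps)
  moreover have "finite (edges (shift \<phi> G))"
    using assms by (simp add: shift_def zlabelled_def)
  ultimately show ?thesis
    using assms unfolding zlabelled_def by (auto simp: in_edges_shift)
qed

lemma switching_shift:
  "i \<in> verts G \<Longrightarrow> switching G (shift (\<lambda>x. if x = i then \<gamma> else 0) G)"
proof -
  assume "i \<in> verts G"
  moreover have "shift (\<lambda>x. if x = i then \<gamma> else 0) G =
      \<lparr>verts = verts G, edges = switch_edge i \<gamma> ` edges G\<rparr>"
    unfolding shift_def by (auto simp: switch_edge_def intro!: image_cong)
  ultimately show ?thesis by (metis switching.intros)
qed

lemma switching_imp_shift:
  assumes "switching G H"
  shows "\<exists>\<phi>. H = shift \<phi> G"
  using assms
proof cases
  case (1 i \<gamma>)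
  have "H = shift (\<lambda>x. if x = i then \<gamma> else 0) G"
    unfolding shift_def 1 by (auto simp: switch_edge_def intro!: image_cong)
  then show ?thesis by blast
qed

lemma shift_shift: "shift \<psi> (shift \<phi> G) = shift (\<lambda>x. \<phi> x + \<psi> x) G"
  unfolding shift_def by (auto simp: image_image intro!: image_cong)

lemma shift_cong:
  assumes "zlabelled G" "\<And>x. x \<in> verts G \<Longrightarrow> \<phi> x = \<psi> x"
  shows "shift \<phi> G = shift \<psi> G"
  unfolding shift_def using assms
  by (auto simp: zlabelledD(3,4)[OF assms(1)] intro!: image_cong)

text \<open>Only the values of the potential on the finitely many vertices matter, so it can be
  built up one vertex at a time.\<close>

lemma switchings_shift:
  assumes "zlabelled G"
  shows "switching\<^sup>*\<^sup>* G (shift \<phi> G)"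
proof -
  have *: "switching\<^sup>*\<^sup>* G (shift (\<lambda>x. if x \<in> S then \<phi> x else 0) G)"
    if "finite S" "S \<subseteq> verts G" for S
    using that
  proof (induction S)
    case empty
    have "shift (\<lambda>x. 0) G = G"
      by (simp add: shift_def case_prod_unfold)
    then show ?case by simp
  next
    case (insert i S)
    let ?H = "shift (\<lambda>x. if x \<in> S then \<phi> x else 0) G"
    have "switching ?H (shift (\<lambda>x. if x = i then \<phi> i else 0) ?H)"
      by (rule switching_shift) (use insert in simp)
    moreover have "shift (\<lambda>x. if x = i then \<phi> i else 0) ?H =
        shift (\<lambda>x. if x \<in> insert i S then \<phi> x else 0) G"
      unfolding shift_shift using insert by (intro shift_cong assms) auto
    ultimately show ?case using insert by (metis insert_subset rtranclp.rtrancl_into_rtrancl)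
  qed
  have "shift (\<lambda>x. if x \<in> verts G then \<phi> x else 0) G = shift \<phi> G"
    by (intro shift_cong assms) auto
  then show ?thesis using *[of "verts G"] zlabelledD(1)[OF assms] by simp
qed

text \<open>An edge of \<open>G\<close> missing from \<open>H\<close> must occur in \<open>H\<close>
  in the opposite direction, so inverting it lowers the number of such edges; once none is left,
  simplicity of the labelling of \<open>H\<close> forces equality.\<close>

lemma inversions_same_sym_edges:
  assumes "zlabelled G" "zlabelled H" "verts G = verts H" "sym_edges G = sym_edges H"
  shows "inversion\<^sup>*\<^sup>* G H"
  using assms
proof (induction "card (edges G - edges H)" arbitrary: G rule: less_induct)
  case less
  show ?case
  proof (cases "edges G \<subseteq> edges H")
    case True
    have "(i, j, \<gamma>) \<in> edges G" if "(i, j, \<gamma>) \<in> edges H" for i j \<gamma>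
    proof (rule ccontr)
      assume "(i, j, \<gamma>) \<notin> edges G"
      with that less.prems(4) have "(j, i, - \<gamma>) \<in> edges G"
        by (metis in_sym_edges)
      with True that zlabelledD(5)[OF less.prems(2)] show False by blast
    qed
    then have "edges G = edges H" using True by auto
    then have "G = H" using less.prems(3) by (cases G; cases H) simp
    then show ?thesis by simp
  next
    case False
    then obtain i j \<gamma> where e: "(i, j, \<gamma>) \<in> edges G" "(i, j, \<gamma>) \<notin> edges H"
      by (metis subsetI prod_cases3)
    define G' where "G' = \<lparr>verts = verts G, edges = insert (j, i, - \<gamma>) (edges G - {(i, j, \<gamma>)})\<rparr>"
    have inv: "inversion G G'"
      unfolding G'_def by (rule inversion.intros) (rule e)
    have "(j, i, - \<gamma>) \<in> edges H"
      using e less.prems(4) by (metis in_sym_edges)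
    then have "edges G' - edges H \<subset> edges G - edges H"
      using e by (auto simp: G'_def)
    then have "card (edges G' - edges H) < card (edges G - edges H)"
      using zlabelledD(2)[OF less.prems(1)] by (simp add: psubset_card_mono)
    then have "inversion\<^sup>*\<^sup>* G' H"
      using less.hyps[of G'] less.prems zlabelled_inversion[OF _ inv] sym_edges_inversion[OF inv]
      by simp
    then show ?thesis using inv by (simp add: converse_rtranclp_into_rtranclp)
  qed
qed

lemma relabellings_shift: "zlabelled G \<Longrightarrow> relabelling\<^sup>*\<^sup>* G (shift \<phi> G)"
  by (rule mono_rtranclp[rule_format, OF _ switchings_shift]) auto

lemma relabellings_same_sym_edges:
  assumes "zlabelled G" "zlabelled H" "verts G = verts H" "sym_edges G = sym_edges H"
  shows "relabelling\<^sup>*\<^sup>* G H"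
  by (rule mono_rtranclp[rule_format, OF _ inversions_same_sym_edges[OF assms]]) auto

lemma relabellings_imp_minor_steps: "relabelling\<^sup>*\<^sup>* G H \<Longrightarrow> minor_step\<^sup>*\<^sup>* G H"
  by (rule mono_rtranclp[rule_format]) auto

lemma isomorphicI:
  assumes "relabelling\<^sup>*\<^sup>* G H" "inj_on f (verts H)"
  shows "isomorphic G (rename f H)"
  unfolding isomorphic_def using assms
  by (intro exI[of _ H] exI[of _ f]) (simp add: rename_def bij_betw_def)

lemma isomorphic_relabelling: "relabelling\<^sup>*\<^sup>* G H \<Longrightarrow> isomorphic G H"
  using isomorphicI[of G H id] by (simp add: rename_def case_prod_unfold)

lemma isomorphic_imp_rename:
  assumes "isomorphic G H"
  obtains G' f where "relabelling\<^sup>*\<^sup>* G G'" "inj_on f (verts G')" "H = rename f G'"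
proof -
  obtain G' f where *: "relabelling\<^sup>*\<^sup>* G G'" "bij_betw f (verts G') (verts H)"
      "edges H = (\<lambda>(i, j, \<gamma>). (f i, f j, \<gamma>)) ` edges G'"
    using assms unfolding isomorphic_def by blast
  then have "H = rename f G'"
    by (cases H) (auto simp: rename_def bij_betw_def)
  with * that show thesis by (auto simp: bij_betw_def)
qed

lemma zlabelled_rename:
  assumes "zlabelled G" "inj_on f (verts G)"
  shows "zlabelled (rename f G)"
proof -
  have "(f j, f i, - \<gamma>) \<notin> edges (rename f G)" if e: "(i, j, \<gamma>) \<in> edges G" for i j \<gamma>
  proof
    assume "(f j, f i, - \<gamma>) \<in> edges (rename f G)"
    then obtain a b where "(a, b, - \<gamma>) \<in> edges G" "f a = f j" "f b = f i"
      by (auto simp: rename_def)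
    moreover from this have "a = j" "b = i"
      using assms e by (metis inj_onD zlabelledD(3,4))+
    ultimately show False using zlabelledD(5)[OF assms(1) e] by simp
  qed
  then have "(b, a, - \<gamma>) \<notin> edges (rename f G)" if "(a, b, \<gamma>) \<in> edges (rename f G)" for a b \<gamma>
    using that by (subst (asm) rename_def) auto
  moreover have "a \<in> verts (rename f G) \<and> b \<in> verts (rename f G)"
    if "(a, b, \<gamma>) \<in> edges (rename f G)" for a b \<gamma>
    using that zlabelledD[OF assms(1)] by (auto simp: rename_def)
  moreover have "finite (verts (rename f G))" "finite (edges (rename f G))"
    using zlabelledD[OF assms(1)] by (auto simp: rename_def)
  ultimately show ?thesis unfolding zlabelled_def by blast
qed

lemma zlabelled_relabelling:
  assumes "relabelling\<^sup>*\<^sup>* G H" "zlabelled G"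
  shows "zlabelled H"
  using assms
proof (induction)
  case (step A B)
  then show ?case
    using zlabelled_inversion switching_imp_shift zlabelled_shift by (metis sup2E)
qed

lemma zlabelled_isomorphic:
  assumes "isomorphic G H" "zlabelled G"
  shows "zlabelled H"
  using assms by (elim isomorphic_imp_rename) (auto intro: zlabelled_rename zlabelled_relabelling)

lemma zlabelled_deletion: "deletion G H \<Longrightarrow> zlabelled G \<Longrightarrow> zlabelled H"
  by (induction rule: deletion.induct)
     (auto simp: zlabelled_def intro: finite_subset[rotated])

lemma zlabelled_minor_steps:
  assumes "minor_step\<^sup>*\<^sup>* G H" "zlabelled G"
  shows "zlabelled H"
  using assms
proof (induction)
  case (step A B)
  then show ?case
    using zlabelled_inversion switching_imp_shift zlabelled_shift zlabelled_deletion
    by (metis contraction.cases)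
qed

lemma deletions_subgraph:
  assumes "zlabelled G" "zlabelled H" "verts H \<subseteq> verts G" "edges H \<subseteq> edges G"
  shows "deletion\<^sup>*\<^sup>* G H"
proof -
  have 1: "deletion\<^sup>*\<^sup>* G \<lparr>verts = verts G, edges = edges G - F\<rparr>"
    if "finite F" "F \<subseteq> edges G" for F
    using that
  proof (induction F)
    case empty
    then show ?case by simp
  next
    case (insert e F)
    have "deletion \<lparr>verts = verts G, edges = edges G - F\<rparr>
        \<lparr>verts = verts G, edges = edges G - insert e F\<rparr>"
      using deletion.del_edge[of e "\<lparr>verts = verts G, edges = edges G - F\<rparr>"] insert
      by (simp add: Diff_insert[of "edges G" e F])
    then show ?case using insert by (simp add: rtranclp.rtrancl_into_rtrancl)
  qed
  let ?G = "\<lparr>verts = verts G, edges = edges H\<rparr>"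
  have "finite (edges G - edges H)" "edges G - (edges G - edges H) = edges H"
    using assms zlabelledD(2) by auto
  with 1[of "edges G - edges H"] have "deletion\<^sup>*\<^sup>* G ?G" by simp
  moreover have "deletion\<^sup>*\<^sup>* ?G \<lparr>verts = verts G - S, edges = edges H\<rparr>"
    if "finite S" "S \<subseteq> verts G - verts H" for S
    using that
  proof (induction S)
    case empty
    then show ?case by simp
  next
    case (insert v S)
    have "{(i, j, \<gamma>) \<in> edges H. i \<noteq> v \<and> j \<noteq> v} = edges H"
      using insert zlabelledD(3,4)[OF assms(2)] by auto
    then have "deletion \<lparr>verts = verts G - S, edges = edges H\<rparr>
        \<lparr>verts = verts G - insert v S, edges = edges H\<rparr>"
      using deletion.del_vertex[of v "\<lparr>verts = verts G - S, edges = edges H\<rparr>"] insert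
      by (simp add: Diff_insert[of "verts G" v S])
    then show ?case using insert by (simp add: rtranclp.rtrancl_into_rtrancl)
  qed
  from this[of "verts G - verts H"] have "deletion\<^sup>*\<^sup>* ?G H"
    using assms zlabelledD(1)[OF assms(1)] by (simp add: double_diff)
  ultimately show ?thesis by simp
qed

section \<open>Choice of orientations, and contraction of edges with arbitrary label\<close>

lemma orientation_exists:
  assumes "finite C" "\<And>a. (a, a, 0) \<notin> C"
  shows "\<exists>X \<subseteq> C. (\<forall>a b \<alpha>. (a, b, \<alpha>) \<in> X \<longrightarrow> (b, a, - \<alpha>) \<notin> X) \<and>
           (\<forall>a b (\<alpha>::int). (a, b, \<alpha>) \<in> C \<longrightarrow> (a, b, \<alpha>) \<in> X \<or> (b, a, - \<alpha>) \<in> X)"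
  using assms
proof (induction C)
  case empty
  then show ?case by simp
next
  case (insert e C)
  obtain x y \<gamma> where e: "e = (x, y, \<gamma>)" by (cases e)
  obtain X where X: "X \<subseteq> C" "\<And>a b \<alpha>. (a, b, \<alpha>) \<in> X \<Longrightarrow> (b, a, - \<alpha>) \<notin> X"
      "\<And>a b \<alpha>. (a, b, \<alpha>) \<in> C \<Longrightarrow> (a, b, \<alpha>) \<in> X \<or> (b, a, - \<alpha>) \<in> X"
    using insert by (metis insert_iff)
  \<comment> \<open>The choice is greedy: an edge is added unless its inverse was taken before. A
    selfloop of label \<open>0\<close> would be its own inverse and has to be excluded.\<close>
  have ne: "\<not> (x = y \<and> \<gamma> = 0)" using insert.prems e by auto
  show ?case
  proof (cases "(y, x, - \<gamma>) \<in> X")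
    case True
    then show ?thesis using X e by (intro exI[of _ X]) auto
  next
    case False
    then show ?thesis using X e ne
      by (intro exI[of _ "insert e X"]) (auto; metis minus_minus)
  qed
qed

text \<open>Replacing the inverses of the edges in \<open>F\<close> by those edges does not change
  the symmetric edge set, and the condition on \<open>F\<close> keeps the labelling simple. This
  brings edges into a prescribed direction before they are kept or contracted.\<close>

lemma reorientation_exists:
  assumes "zlabelled G" "F \<subseteq> sym_edges G" "\<And>a b \<alpha>. (a, b, \<alpha>) \<in> F \<Longrightarrow> (b, a, - \<alpha>) \<notin> F"
  obtains H where "zlabelled H" "verts H = verts G" "sym_edges H = sym_edges G" "F \<subseteq> edges H"
proof -
  define E where "E = {(i, j, \<gamma>) \<in> edges G. (j, i, - \<gamma>) \<notin> F} \<union> F"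
  define H where "H = \<lparr>verts = verts G, edges = E\<rparr>"
  have sym: "sym_edges H = sym_edges G"
    using assms(2,3) by (force simp: H_def E_def sym_edges_def)
  have "finite E"
    by (rule finite_subset[OF _ finite_sym_edges[OF assms(1)]])
       (use assms(2) in \<open>auto simp: E_def in_sym_edges\<close>)
  moreover have "(j, i, - \<gamma>) \<notin> E" if "(i, j, \<gamma>) \<in> E" for i j \<gamma>
    using that assms(3) zlabelledD(5)[OF assms(1), of i j \<gamma>]
    unfolding E_def by (auto; metis minus_minus)
  moreover have "i \<in> verts G \<and> j \<in> verts G" if "(i, j, \<gamma>) \<in> E" for i j \<gamma>
    using that assms(2) sym_edges_verts[OF assms(1), of i j \<gamma>] in_sym_edges[of i j \<gamma> G]
    unfolding E_def by auto
  ultimately have "zlabelled H"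
    using zlabelledD(1)[OF assms(1)] unfolding zlabelled_def H_def by auto
  then show thesis using that[of H] sym by (simp add: H_def E_def)
qed

text \<open>Deletions cannot turn an edge around, so \<open>G\<close> is first reoriented to contain
  the edges of \<open>H\<close> literally.\<close>

lemma minor_steps_subgraph:
  assumes "zlabelled G" "zlabelled H" "verts H \<subseteq> verts G" "edges H \<subseteq> sym_edges G"
  shows "minor_step\<^sup>*\<^sup>* G H"
proof -
  obtain G' where G': "zlabelled G'" "verts G' = verts G" "sym_edges G' = sym_edges G"
      "edges H \<subseteq> edges G'"
    using reorientation_exists[OF assms(1,4) zlabelledD(5)[OF assms(2)]] .
  have "minor_step\<^sup>*\<^sup>* G G'"
    by (rule relabellings_imp_minor_steps, rule relabellings_same_sym_edges) (use assms G' in auto)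
  moreover have "minor_step\<^sup>*\<^sup>* G' H"
    by (rule mono_rtranclp[rule_format, OF _ deletions_subgraph]) (use assms G' in auto)
  ultimately show ?thesis by simp
qed

text \<open>Only label \<open>0\<close> may be contracted, so a switching at \<open>y\<close> by
  \<open>\<gamma>\<close> comes first; this is the potential \<open>\<phi>\<close>. Describing the
  result through \<open>sym_edges\<close> hides which edge of a redundant inverse pair is
  kept.\<close>

lemma contraction_along:
  assumes G: "zlabelled G" and e: "(x, y, \<gamma>) \<in> sym_edges G" and "x \<noteq> y"
  defines "f \<equiv> \<lambda>a. if a = y then x else a" and "\<phi> \<equiv> \<lambda>a. if a = y then \<gamma> else 0"
  obtains H where "zlabelled H" "minor_step\<^sup>*\<^sup>* G H" "verts H = verts G - {y}"
    "sym_edges H =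
       (\<lambda>(a, b, \<alpha>). (f a, f b, \<alpha> + \<phi> a - \<phi> b)) ` sym_edges G - {(a, a, 0) |a. True}"
proof -
  have zs: "zlabelled (shift \<phi> G)" using G by (rule zlabelled_shift)
  have "(x, y, 0) \<in> sym_edges (shift \<phi> G)"
    using e \<open>x \<noteq> y\<close> by (simp add: in_sym_shift \<phi>_def)
  then obtain G' where G': "zlabelled G'" "verts G' = verts G"
      "sym_edges G' = sym_edges (shift \<phi> G)" "(x, y, 0) \<in> edges G'"
    using reorientation_exists[OF zs, of "{(x, y, 0)}"] \<open>x \<noteq> y\<close> by auto
  have 1: "minor_step\<^sup>*\<^sup>* G G'"
  proof -
    have "relabelling\<^sup>*\<^sup>* (shift \<phi> G) G'"
      using relabellings_same_sym_edges[OF zs G'(1)] G' by simp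
    with relabellings_shift[OF G, of \<phi>] have "relabelling\<^sup>*\<^sup>* G G'" by (rule rtranclp_trans)
    then show ?thesis by (rule relabellings_imp_minor_steps)
  qed
  let ?C = "contracted_edges x y (edges G')"
  have "finite ?C" unfolding contracted_edges_def using zlabelledD(2)[OF G'(1)] by simp
  moreover have "(a, a, 0) \<notin> ?C" for a by (simp add: contracted_edges_def)
  ultimately obtain X where X: "X \<subseteq> ?C" "\<And>a b \<alpha>. (a, b, \<alpha>) \<in> X \<Longrightarrow> (b, a, - \<alpha>) \<notin> X"
      "\<And>a b \<alpha>. (a, b, \<alpha>) \<in> ?C \<Longrightarrow> (a, b, \<alpha>) \<in> X \<or> (b, a, - \<alpha>) \<in> X"
    using orientation_exists[of ?C] by auto
  define H where "H = \<lparr>verts = verts G - {y}, edges = X\<rparr>"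
  have x: "x \<in> verts G" using sym_edges_verts[OF G e] by simp
  have C_verts: "a \<in> verts G - {y} \<and> b \<in> verts G - {y}" if "(a, b, \<alpha>) \<in> ?C" for a b \<alpha>
    using that x G'(2) \<open>x \<noteq> y\<close> zlabelledD(3,4)[OF G'(1)]
    by (auto simp: contracted_edges_def split: if_splits)
  have zH: "zlabelled H"
    unfolding zlabelled_def H_def
    using X(2) subsetD[OF X(1), THEN C_verts] zlabelledD(1)[OF G]
      finite_subset[OF X(1) \<open>finite ?C\<close>] by simp
  have "contraction G' H"
    by (rule contraction.intros[of x y]) (use G' \<open>x \<noteq> y\<close> zH X in \<open>auto simp: H_def\<close>)
  with 1 have 2: "minor_step\<^sup>*\<^sup>* G H" by (simp add: rtranclp.rtrancl_into_rtrancl)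
  let ?g = "\<lambda>(a, b, \<alpha>). (f a, f b, \<alpha> :: int)"
  \<comment> \<open>The contracted edge becomes a selfloop of label \<open>0\<close> itself, so
    removing these selfloops already accounts for it.\<close>
  have C: "?C = ?g ` edges G' - {(a, a, 0) |a. True}"
    by (force simp: contracted_edges_def f_def)
  have symH: "(a, b, \<alpha>) \<in> sym_edges H \<longleftrightarrow> (a, b, \<alpha>) \<in> ?C \<or> (b, a, - \<alpha>) \<in> ?C" for a b \<alpha>
    unfolding in_sym_edges H_def using X(1) X(3)[of a b \<alpha>] X(3)[of b a "- \<alpha>"] by auto
  have "sym_edges H = ?g ` sym_edges G' - {(a, a, 0) |a. True}"
  proof -
    have "(a, b, \<alpha>) \<in> sym_edges H \<longleftrightarrow> (a, b, \<alpha>) \<in> ?g ` sym_edges G' - {(a, a, 0) |a. True}"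
      for a b \<alpha>
    proof -
      have "(a, b, \<alpha>) \<in> ?g ` sym_edges G' \<longleftrightarrow>
          (\<exists>c d. f c = a \<and> f d = b \<and> ((c, d, \<alpha>) \<in> edges G' \<or> (d, c, - \<alpha>) \<in> edges G'))"
        by (force simp: image_iff sym_edges_def)
      moreover have "(a, b, \<alpha>) \<in> ?g ` edges G' \<longleftrightarrow>
          (\<exists>c d. f c = a \<and> f d = b \<and> (c, d, \<alpha>) \<in> edges G')"
        by (force simp: image_iff)
      moreover have "(b, a, - \<alpha>) \<in> ?g ` edges G' \<longleftrightarrow>
          (\<exists>c d. f c = a \<and> f d = b \<and> (d, c, - \<alpha>) \<in> edges G')"
        by (force simp: image_iff)
      ultimately show ?thesis unfolding symH C by auto
    qed
    then show ?thesis by (simp add: set_eq_iff split_paired_all)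
  qed
  also have "sym_edges G' = (\<lambda>(a, b, \<alpha>). (a, b, \<alpha> + \<phi> a - \<phi> b)) ` sym_edges G"
    unfolding G'(3) by (force simp: image_iff in_sym_shift)
  finally have "sym_edges H =
      (\<lambda>(a, b, \<alpha>). (f a, f b, \<alpha> + \<phi> a - \<phi> b)) ` sym_edges G - {(a, a, 0) |a. True}"
    by (simp add: image_image case_prod_unfold)
  with zH 2 that show thesis by (simp add: H_def)
qed

section \<open>Planar realizations\<close>

text \<open>An edge is represented by its lift from \<open>(i, 0)\<close> to
  \<open>(j, \<gamma>)\<close>, hence the subtraction of \<open>\<gamma>\<close> lattice vectors.
  The plane is the complex numbers, where rotations are multiplications by unit numbers; lengths are
  compared through their squares.\<close>

definition same_length ::
  "nat \<Rightarrow> (nat \<Rightarrow> real) \<Rightarrow> ('v \<Rightarrow> nat \<Rightarrow> real) \<Rightarrow> ('v \<Rightarrow> complex) \<Rightarrow> 'v \<times> 'v \<times> int \<Rightarrow> bool" where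
  "same_length n l q q' = (\<lambda>(i, j, \<gamma>).
     (cmod (q' i - q' j - of_real (of_int \<gamma> * sqrt (\<Sum>k<n. (l k)\<^sup>2))))\<^sup>2 =
     (\<Sum>k<n. (q i k - q j k - of_int \<gamma> * l k)\<^sup>2))"

text \<open>
  Realizability in the plane, read off the orbit representatives \<open>q i\<close> of a periodic framework
  \<open>(i, \<gamma>) \<mapsto> q i + \<gamma> l\<close>; a rotation makes the lattice vector of the planar framework a positive real.
\<close>

definition planar :: "'v zgraph \<Rightarrow> bool" where
  "planar G \<longleftrightarrow> (\<forall>n l q. (\<Sum>k<n. (l k)\<^sup>2) > 0 \<longrightarrow> (\<exists>q'. \<forall>e \<in> edges G. same_length n l q q' e))"

lemma planarI:
  assumes "\<And>n l q. (\<Sum>k<n. (l k)\<^sup>2) > 0 \<Longrightarrow> \<exists>q'. \<forall>i j \<gamma>. (i, j, \<gamma>) \<in> edges G \<longrightarrow>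
    same_length n l q q' (i, j, \<gamma>)"
  shows "planar G"
  using assms unfolding planar_def by (metis prod_cases3)

lemma planarE:
  assumes "planar G" "(\<Sum>k<n. (l k)\<^sup>2) > 0"
  obtains q' where "\<And>i j \<gamma>. (i, j, \<gamma>) \<in> edges G \<Longrightarrow> same_length n l q q' (i, j, \<gamma>)"
  using assms unfolding planar_def by blast

lemma planar_subset: "planar G \<Longrightarrow> edges H \<subseteq> edges G \<Longrightarrow> planar H"
  unfolding planar_def by (meson subsetD)

lemma edges_subset_sym_edges: "edges G \<subseteq> sym_edges G"
  by (auto simp: in_sym_edges)

lemma same_length_swap: "same_length n l q q' (j, i, - \<gamma>) \<longleftrightarrow> same_length n l q q' (i, j, \<gamma>)"
proof -
  have "cmod (q' j - q' i - of_real (of_int (- \<gamma>) * L)) = cmod (q' i - q' j - of_real (of_int \<gamma> * L))"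
    for L
    by (subst norm_minus_cancel[symmetric]) (simp add: algebra_simps)
  moreover have "(q j k - q i k - of_int (- \<gamma>) * l k)\<^sup>2 = (q i k - q j k - of_int \<gamma> * l k)\<^sup>2" for k
    by (subst power2_minus[symmetric]) (simp add: algebra_simps)
  ultimately show ?thesis unfolding same_length_def by simp
qed

lemma planar_sym_subset:
  assumes "planar G" "edges H \<subseteq> sym_edges G"
  shows "planar H"
proof (rule planarI)
  fix n :: nat and l q
  assume pos: "(\<Sum>k<n. (l k)\<^sup>2) > (0::real)"
  obtain q' where q': "\<And>i j \<gamma>. (i, j, \<gamma>) \<in> edges G \<Longrightarrow> same_length n l q q' (i, j, \<gamma>)"
    using planarE[OF assms(1) pos] by blast
  have "same_length n l q q' (i, j, \<gamma>)" if "(i, j, \<gamma>) \<in> edges H" for i j \<gamma>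
    using subsetD[OF assms(2) that] q' iffD1[OF same_length_swap q'] unfolding in_sym_edges by blast
  then show "\<exists>q'. \<forall>i j \<gamma>. (i, j, \<gamma>) \<in> edges H \<longrightarrow> same_length n l q q' (i, j, \<gamma>)" by blast
qed

text \<open>Switching is a change of orbit representatives: moving the given and the planar
  positions of \<open>i\<close> by the same multiple \<open>\<phi> i\<close> of the lattice vector
  absorbs the change of labels.\<close>

lemma planar_shift:
  assumes "planar G"
  shows "planar (shift \<phi> G)"
proof (rule planarI)
  fix n :: nat and l q
  assume pos: "(\<Sum>k<n. (l k)\<^sup>2) > (0::real)"
  let ?L = "sqrt (\<Sum>k<n. (l k)\<^sup>2)"
  obtain q' where q': "\<And>i j \<gamma>. (i, j, \<gamma>) \<in> edges G \<Longrightarrow>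
      same_length n l (\<lambda>i k. q i k - \<phi> i * l k) q' (i, j, \<gamma>)"
    using planarE[OF assms pos] by blast
  have "same_length n l q (\<lambda>i. q' i + \<phi> i * ?L) (i, j, \<gamma>)"
    if "(i, j, \<gamma>) \<in> edges (shift \<phi> G)" for i j \<gamma>
    using q'[of i j "\<gamma> - \<phi> i + \<phi> j"] that
    by (simp add: in_edges_shift algebra_simps same_length_def)
  then show "\<exists>q'. \<forall>i j \<gamma>. (i, j, \<gamma>) \<in> edges (shift \<phi> G) \<longrightarrow> same_length n l q q' (i, j, \<gamma>)"
    by blast
qed

lemma planar_relabelling:
  assumes "relabelling\<^sup>*\<^sup>* G H"
  shows "planar G \<longleftrightarrow> planar H"
  using assms
proof (induction)
  case (step A B)
  have "planar A \<longleftrightarrow> planar B" if "sym_edges A = sym_edges B"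
    using that planar_sym_subset edges_subset_sym_edges by metis
  moreover have "planar A \<longleftrightarrow> planar B" if "B = shift \<phi> A" for \<phi>
  proof -
    have "A = shift (\<lambda>x. - \<phi> x) B"
      unfolding that shift_shift by (simp add: shift_def case_prod_unfold)
    with that planar_shift show ?thesis by metis
  qed
  ultimately have "planar A \<longleftrightarrow> planar B"
    using step(2) sym_edges_inversion(1) switching_imp_shift by (metis sup2E)
  with step show ?case by simp
qed simp

lemma planar_rename:
  assumes "zlabelled G" "inj_on f (verts G)"
  shows "planar (rename f G) \<longleftrightarrow> planar G"
proof -
  define g where "g = inv_into (verts G) f"
  have g: "g (f i) = i" if "i \<in> verts G" for i
    using that assms(2) by (simp add: g_def)
  have ge: "g (f i) = i" "g (f j) = j" if "(i, j, \<gamma>) \<in> edges G" for i j \<gamma>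
    using that g zlabelledD(3,4)[OF assms(1)] by auto
  show ?thesis
  proof
    assume p: "planar (rename f G)"
    show "planar G"
    proof (rule planarI)
      fix n :: nat and l q
      assume pos: "(\<Sum>k<n. (l k)\<^sup>2) > (0::real)"
      obtain q' where q': "\<And>i j \<gamma>. (i, j, \<gamma>) \<in> edges (rename f G) \<Longrightarrow>
          same_length n l (\<lambda>x. q (g x)) q' (i, j, \<gamma>)"
        using planarE[OF p pos] by blast
      have "same_length n l q (\<lambda>x. q' (f x)) (i, j, \<gamma>)" if e: "(i, j, \<gamma>) \<in> edges G" for i j \<gamma>
      proof -
        have "(f i, f j, \<gamma>) \<in> edges (rename f G)" using e by (force simp: rename_def)
        from q'[OF this] show ?thesis using ge[OF e] by (simp add: same_length_def)
      qed
      then show "\<exists>q'. \<forall>i j \<gamma>. (i, j, \<gamma>) \<in> edges G \<longrightarrow> same_length n l q q' (i, j, \<gamma>)" by blast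
    qed
  next
    assume p: "planar G"
    show "planar (rename f G)"
    proof (rule planarI)
      fix n :: nat and l q
      assume pos: "(\<Sum>k<n. (l k)\<^sup>2) > (0::real)"
      obtain q' where q': "\<And>i j \<gamma>. (i, j, \<gamma>) \<in> edges G \<Longrightarrow>
          same_length n l (\<lambda>x. q (f x)) q' (i, j, \<gamma>)"
        using planarE[OF p pos] by blast
      have "same_length n l q (\<lambda>x. q' (g x)) (a, b, \<gamma>)"
        if e: "(a, b, \<gamma>) \<in> edges (rename f G)" for a b \<gamma>
      proof -
        obtain i j where ij: "(i, j, \<gamma>) \<in> edges G" "a = f i" "b = f j"
          using e by (auto simp: rename_def)
        from q'[OF ij(1)] show ?thesis using ge[OF ij(1)] ij by (simp add: same_length_def)
      qed
      then show "\<exists>q'. \<forall>i j \<gamma>. (i, j, \<gamma>) \<in> edges (rename f G) \<longrightarrow> same_length n l q q' (i, j, \<gamma>)"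
        by blast
    qed
  qed
qed

lemma planar_isomorphic:
  assumes "isomorphic G H" "zlabelled G"
  shows "planar G \<longleftrightarrow> planar H"
  using assms(1)
proof (rule isomorphic_imp_rename)
  fix G' f
  assume *: "relabelling\<^sup>*\<^sup>* G G'" "inj_on f (verts G')" "H = rename f G'"
  then have "zlabelled G'" using assms(2) zlabelled_relabelling by blast
  with * planar_relabelling[OF *(1)] planar_rename show ?thesis by blast
qed

lemma planar_contraction:
  assumes "contraction G H" "planar G"
  shows "planar H"
  using assms(1)
proof cases
  case (1 i j)
  let ?f = "\<lambda>a. if a = j then i else a"
  show ?thesis
  proof (rule planarI)
    fix n :: nat and l q
    assume pos: "(\<Sum>k<n. (l k)\<^sup>2) > (0::real)"
    obtain q' where q': "\<And>a b \<gamma>. (a, b, \<gamma>) \<in> edges G \<Longrightarrow>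
        same_length n l (\<lambda>a. q (?f a)) q' (a, b, \<gamma>)"
      using planarE[OF assms(2) pos] by metis
    \<comment> \<open>In the framework pulled back along \<open>?f\<close> the contracted edge has
      label and length zero, so its ends must coincide in the plane.\<close>
    have "q' i = q' j" using q'[OF 1(1)] by (simp add: same_length_def)
    then have f: "q' (?f a) = q' a" for a by simp
    have "same_length n l q q' (a, b, \<gamma>)" if "(a, b, \<gamma>) \<in> edges H" for a b \<gamma>
    proof -
      have "(a, b, \<gamma>) \<in> contracted_edges i j (edges G)" using that 1 by blast
      then obtain c d where cd: "(c, d, \<gamma>) \<in> edges G" "a = ?f c" "b = ?f d"
        by (auto simp: contracted_edges_def)
      then show ?thesis using q'[OF cd(1)] f[of c] f[of d] unfolding same_length_def by simp
    qed
    then show "\<exists>q'. \<forall>i j \<gamma>. (i, j, \<gamma>) \<in> edges H \<longrightarrow> same_length n l q q' (i, j, \<gamma>)" by blast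
  qed
qed

lemma edges_deletion: "deletion G H \<Longrightarrow> edges H \<subseteq> edges G"
  by (induction rule: deletion.induct) auto

lemma planar_minor:
  assumes "minor_of H G" "zlabelled G" "planar G"
  shows "planar H"
proof -
  obtain G' where G': "minor_step\<^sup>*\<^sup>* G G'" "isomorphic G' H"
    using assms(1) unfolding minor_of_def by blast
  from G'(1) have "planar G'"
  proof (induction)
    case (step A B)
    have "relabelling\<^sup>*\<^sup>* A B" if "inversion A B \<or> switching A B"
      using that by auto
    then show ?case
      using step planar_relabelling[of A B] planar_contraction edges_deletion planar_subset by blast
  qed (rule assms(3))
  then show ?thesis
    using planar_isomorphic[OF G'(2)] zlabelled_minor_steps[OF G'(1)] assms(2) by simp
qed

section \<open>The forbidden graphs are not realizable in the plane\<close>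

lemma not_planar_K4:
  assumes "is_K0 4 K"
  shows "\<not> planar K"
proof
  assume p: "planar K"
  obtain a b c d where V: "verts K = {a, b, c, d}" and
    ne: "a \<noteq> b" "a \<noteq> c" "a \<noteq> d" "b \<noteq> c" "b \<noteq> d" "c \<noteq> d"
    using assms unfolding is_K0_def
    by (auto simp: card_Suc_eq numeral_eq_Suc)
  \<comment> \<open>The vertices become the standard basis of 4-space, with squared distances 2.
    Edges of label \<open>0\<close> do not see the lattice vector, so the constant vector of ones
    serves.\<close>
  define q :: "'a \<Rightarrow> nat \<Rightarrow> real" where
    "q = (\<lambda>x k. if k = (if x = a then 0 else if x = b then 1 else if x = c then 2 else 3) then 1 else 0)"
  have pos: "(\<Sum>k<4::nat. (1::real)\<^sup>2) > 0" by simp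
  obtain q' where "\<And>i j \<gamma>. (i, j, \<gamma>) \<in> edges K \<Longrightarrow> same_length 4 (\<lambda>_. 1) q q' (i, j, \<gamma>)"
    using planarE[OF p pos] by blast
  then have q': "(cmod (q' i - q' j))\<^sup>2 = (\<Sum>k<4. (q i k - q j k)\<^sup>2)"
    if "(i, j, 0) \<in> edges K" for i j
    using that unfolding same_length_def by force
  have dist: "(cmod (q' j - q' i))\<^sup>2 = 2"
    if ij: "i \<in> verts K" "j \<in> verts K" "i \<noteq> j" for i j
  proof -
    have 2: "(\<Sum>k<4. (q i k - q j k)\<^sup>2) = 2" if "i \<in> verts K" "j \<in> verts K" "i \<noteq> j" for i j
      using that ne unfolding V q_def by (auto simp: numeral_eq_Suc)
    have "(i, j, 0) \<in> edges K \<or> (j, i, 0) \<in> edges K"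
      using ij assms unfolding is_K0_def by blast
    then show ?thesis
      using q'[of i j] q'[of j i] 2[of i j] 2[of j i] ij by (auto simp: norm_minus_commute)
  qed
  define w where "w = (\<lambda>x. q' x - q' a)"
  define ip where "ip = (\<lambda>u v. Re u * Re v + Im u * Im v)"
  have ip: "(cmod u)\<^sup>2 = ip u u" for u
    unfolding cmod_power2[of u] by (simp add: ip_def power2_eq_square)
  have n: "ip (w x) (w x) = 2" if "x \<in> {b, c, d}" for x
    using dist[of a x] that ne V by (auto simp: w_def ip)
  have m: "ip (w x) (w y) = 1" if "x \<in> {b, c, d}" "y \<in> {b, c, d}" "x \<noteq> y" for x y
  proof -
    have "(cmod (w y - w x))\<^sup>2 = 2"
      using dist[of x y] that ne V by (auto simp: w_def)
    then have "ip (w x) (w x) + ip (w y) (w y) - 2 * ip (w x) (w y) = 2"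
      unfolding ip by (simp add: ip_def algebra_simps)
    with n that show ?thesis by simp
  qed
  define cr where "cr = (\<lambda>u v. Re u * Im v - Im u * Re v)"
  \<comment> \<open>This identity between cross and inner products is special to the plane. The
    inner products 2 and 1 give two cross products with squares 3 and product 1, so that 1 would
    equal 9.\<close>
  have "cr u v * cr u t = ip u u * ip v t - ip u v * ip u t" for u v t
    by (simp add: cr_def ip_def algebra_simps)
  then have "cr (w b) (w c) * cr (w b) (w d) = 1" "(cr (w b) (w c))\<^sup>2 = 3" "(cr (w b) (w d))\<^sup>2 = 3"
    using n m ne by (auto simp: power2_eq_square)
  then show False by (metis (no_types) power_mult_distrib one_power2 mult_numeral_1_right
      numeral_times_numeral numeral_eq_one_iff num.distinct semiring_norm(16) numeral_One)
qed

text \<open>The edge vectors between vertex \<open>3\<close> and the vertices \<open>1\<close> and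
  \<open>2\<close> are chosen as unit vectors orthogonal to the lattice vector and to each other. In
  the plane each has only two opposite candidates, so their heights differ by 0 or 2, while the
  single edge demands a squared difference of 2.\<close>

lemma not_planar_K3dd:
  assumes "is_K3dd K"
  shows "\<not> planar K"
proof
  assume p: "planar K"
  obtain a b b' c c' where ne: "b \<noteq> b'" "c \<noteq> c'" and
    K: "K = \<lparr>verts = {1, 2, 3},
          edges = {(1, 2, a), (1, 3, b), (1, 3, b'), (2, 3, c), (2, 3, c')}\<rparr>"
    using assms unfolding is_K3dd_def by blast
  define l :: "nat \<Rightarrow> real" where "l = (\<lambda>k. if k = 0 then 1 else 0)"
  \<comment> \<open>Coordinate \<open>0\<close> is reserved for the lattice vector, and the vertices
    \<open>1\<close> and \<open>2\<close> lie on the two other axes. Vertex \<open>3\<close> is at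
    the origin, since coordinate \<open>3\<close> is outside the range of the sums.\<close>
  define q :: "nat \<Rightarrow> nat \<Rightarrow> real" where "q = (\<lambda>x k. if k = x then 1 else 0)"
  have l1: "(\<Sum>k<3. (l k)\<^sup>2) = 1" by (simp add: l_def numeral_eq_Suc)
  then have pos: "(\<Sum>k<3. (l k)\<^sup>2) > 0" by simp
  obtain q' where "\<And>i j \<gamma>. (i, j, \<gamma>) \<in> edges K \<Longrightarrow> same_length 3 l q q' (i, j, \<gamma>)"
    using planarE[OF p pos] by blast
  then have q': "(cmod (q' i - q' j - of_int \<gamma>))\<^sup>2 = (\<Sum>k<3. (q i k - q j k - of_int \<gamma> * l k)\<^sup>2)"
    if "(i, j, \<gamma>) \<in> edges K" for i j \<gamma>
    using that l1 unfolding same_length_def by force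
  define u v where "u = q' 1 - q' 3" and "v = q' 2 - q' 3"
  have len: "(cmod (x - of_int \<gamma>))\<^sup>2 = (Re x - of_int \<gamma>)\<^sup>2 + (Im x)\<^sup>2" for x \<gamma>
    by (simp add: cmod_power2)
  have "(\<Sum>k<3. (q i k - q 3 k - of_int \<gamma> * l k)\<^sup>2) = 1 + (of_int \<gamma>)\<^sup>2"
    if "i = 1 \<or> i = 2" for i and \<gamma> :: int
    using that by (auto simp: q_def l_def numeral_eq_Suc)
  then have eqs: "(cmod (u - of_int b))\<^sup>2 = 1 + (of_int b)\<^sup>2" "(cmod (u - of_int b'))\<^sup>2 = 1 + (of_int b')\<^sup>2"
    "(cmod (v - of_int c))\<^sup>2 = 1 + (of_int c)\<^sup>2" "(cmod (v - of_int c'))\<^sup>2 = 1 + (of_int c')\<^sup>2"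
    using q'[of 1 3 b] q'[of 1 3 b'] q'[of 2 3 c] q'[of 2 3 c'] by (simp_all add: K u_def v_def)
  \<comment> \<open>The difference of the two length equations is linear in \<open>Re x\<close> with
    a nonzero coefficient, so the component along the lattice vector vanishes.\<close>
  have perp: "Re x = 0 \<and> (Im x)\<^sup>2 = 1"
    if "\<beta> \<noteq> \<beta>'" "(cmod (x - of_int \<beta>))\<^sup>2 = 1 + (of_int \<beta>)\<^sup>2"
      "(cmod (x - of_int \<beta>'))\<^sup>2 = 1 + (of_int \<beta>')\<^sup>2" for x and \<beta> \<beta>' :: int
  proof -
    have 1: "(Re x)\<^sup>2 + (Im x)\<^sup>2 - 2 * of_int \<beta> * Re x = 1"
      "(Re x)\<^sup>2 + (Im x)\<^sup>2 - 2 * of_int \<beta>' * Re x = 1"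
      using that(2,3) unfolding len by (simp_all add: power2_eq_square algebra_simps)
    then have "of_int (\<beta> - \<beta>') * Re x = 0" by (simp add: algebra_simps)
    then have "Re x = 0" using that(1) by simp
    with 1 show ?thesis by simp
  qed
  have "u - v = q' 1 - q' 2" by (simp add: u_def v_def)
  then have "(cmod (u - v - of_int a))\<^sup>2 = 2 + (of_int a)\<^sup>2"
    using q'[of 1 2 a] by (simp add: K q_def l_def numeral_eq_Suc)
  then have "(Im u - Im v)\<^sup>2 = 2"
    using perp[OF ne(1) eqs(1,2)] perp[OF ne(2) eqs(3,4)] by (simp add: len)
  moreover have "Im u = 1 \<or> Im u = -1" "Im v = 1 \<or> Im v = -1"
    using perp[OF ne(1) eqs(1,2)] perp[OF ne(2) eqs(3,4)] by (simp_all add: power2_eq_1_iff)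
  ultimately show False by auto
qed

section \<open>The realization dimension\<close>

text \<open>One Gram-Schmidt step per vector: split off the component along \<open>v z\<close> as a
  new coordinate and apply induction to the residues. Finitely many vectors thus need no more
  dimensions than their number.\<close>

lemma gram_realization:
  fixes v :: "'a \<Rightarrow> nat \<Rightarrow> real"
  assumes "finite S"
  shows "\<exists>w :: 'a \<Rightarrow> nat \<Rightarrow> real. (\<forall>x \<in> S. \<forall>k \<ge> card S. w x k = 0) \<and>
           (\<forall>x \<in> S. \<forall>y \<in> S. (\<Sum>k<card S. w x k * w y k) = (\<Sum>k<n. v x k * v y k))"
  using assms
proof (induction S arbitrary: v)
  case empty
  then show ?case by simp
next
  case (insert z S)
  define N where "N = sqrt (\<Sum>k<n. v z k * v z k)"
  have nn: "(\<Sum>k<n. v z k * v z k) \<ge> 0" by (simp add: sum_nonneg)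
  have N2: "N * N = (\<Sum>k<n. v z k * v z k)" unfolding N_def using nn by simp
  \<comment> \<open>For \<open>N = 0\<close> the division yields \<open>0\<close>, the right
    coefficient because \<open>v z\<close> then vanishes on the first \<open>n\<close>
    coordinates.\<close>
  define c where "c x = (\<Sum>k<n. v x k * v z k) / N" for x
  have c: "c x * N = (\<Sum>k<n. v x k * v z k)" for x
  proof (cases "N = 0")
    case True
    then have "(\<Sum>k<n. v z k * v z k) = 0" using N2 by simp
    then have "v z k = 0" if "k < n" for k
      using that by (auto simp: sum_nonneg_eq_0_iff)
    then show ?thesis using True by simp
  qed (simp add: c_def)
  have "c z = N" unfolding c_def N2[symmetric] by simp
  define u where "u x k = v x k - c x * inverse N * v z k" for x k
  obtain w where w: "\<And>x k. x \<in> S \<Longrightarrow> k \<ge> card S \<Longrightarrow> w x k = 0"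
      "\<And>x y. x \<in> S \<Longrightarrow> y \<in> S \<Longrightarrow> (\<Sum>k<card S. w x k * w y k) = (\<Sum>k<n. u x k * u y k)"
    using insert.IH[of u] by blast
  have u: "(\<Sum>k<n. u x k * u y k) = (\<Sum>k<n. v x k * v y k) - c x * c y" for x y
  proof -
    have "(\<Sum>k<n. u x k * u y k) = (\<Sum>k<n. v x k * v y k) - c y * inverse N * (\<Sum>k<n. v x k * v z k)
        - c x * inverse N * (\<Sum>k<n. v y k * v z k)
        + c x * c y * inverse N * inverse N * (\<Sum>k<n. v z k * v z k)"
      unfolding sum_distrib_left sum_subtractf[symmetric] sum.distrib[symmetric]
      by (rule sum.cong) (simp_all add: u_def algebra_simps)
    also have "\<dots> = (\<Sum>k<n. v x k * v y k) - c x * c y"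
      unfolding c[symmetric] \<open>c z = N\<close>
      by (cases "N = 0") (simp add: c_def, simp add: field_simps)
    finally show ?thesis .
  qed
  \<comment> \<open>Coordinate \<open>0\<close> holds the component along \<open>v z\<close>, the
    others realize the residues. The residue of \<open>z\<close> is zero on the first
    \<open>n\<close> coordinates; the induction hypothesis does not speak of \<open>w z\<close>, so
    zero is put in explicitly.\<close>
  define w' where "w' x k = (case k of 0 \<Rightarrow> c x | Suc k \<Rightarrow> if x = z then 0 else w x k)" for x k
  have card: "card (insert z S) = Suc (card S)" using insert by simp
  have "w' x k = 0" if "x \<in> insert z S" "k \<ge> card (insert z S)" for x k
    using that w(1)[of x "k - 1"] unfolding card by (cases k) (auto simp: w'_def)
  moreover have "(\<Sum>k<card (insert z S). w' x k * w' y k) = (\<Sum>k<n. v x k * v y k)"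
    if xy: "x \<in> insert z S" "y \<in> insert z S" for x y
  proof -
    have sum_eq: "(\<Sum>k<card (insert z S). w' x k * w' y k) =
        c x * c y + (\<Sum>k<card S. (if x = z then 0 else w x k) * (if y = z then 0 else w y k))"
      unfolding card sum.lessThan_Suc_shift by (simp add: w'_def)
    consider "x = z" | "y = z" | "x \<in> S" "y \<in> S" "x \<noteq> z" "y \<noteq> z"
      using xy insert.hyps by auto
    then show ?thesis
    proof cases
      case 1
      then show ?thesis
        using sum_eq c[of y] \<open>c z = N\<close>
        by (simp add: mult.commute[of "v z _"] mult.commute[of N])
    next
      case 2
      then show ?thesis
        using sum_eq c[of x] \<open>c z = N\<close> by simp
    next
      case 3
      then show ?thesis using sum_eq w(2)[of x y] u[of x y] by simp
    qed
  qed
  ultimately show ?case by blast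
qed

lemma in_Euclidean: "x \<in> topspace (Euclidean_space n) \<longleftrightarrow> (\<forall>k \<ge> n. x k = 0)"
  by (simp add: topspace_Euclidean_space)

lemma framework_position:
  assumes "periodic_framework G n l p" "i \<in> verts G"
  shows "p (i, \<gamma>) k = p (i, 0) k + of_int \<gamma> * l k"
proof -
  have step: "p (i, \<gamma> + 1) k = p (i, \<gamma>) k + l k" for \<gamma>
    using assms unfolding periodic_framework_def lift_verts_def
    by (smt (verit) SigmaI UNIV_I)
  show ?thesis
  proof (induction \<gamma> rule: int_induct[of _ 0])
    case (step2 i)
    then show ?case using step[of "i - 1"] by (simp add: algebra_simps)
  qed (use step in \<open>simp_all add: algebra_simps\<close>)
qed

text \<open>Translation by the lattice vector carries every lift of an edge to the one starting at
  level \<open>0\<close>, so one equation per edge of \<open>G\<close> suffices.\<close>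

lemma equivalent_frameworksI:
  assumes G: "zlabelled G"
    and fw: "periodic_framework G n l p" "periodic_framework G d l' p'"
    and len: "L2_set l {..<n} = L2_set l' {..<d}"
    and eq: "\<And>i j \<gamma>. (i, j, \<gamma>) \<in> edges G \<Longrightarrow>
      (\<Sum>k<n. (p (i, 0) k - p (j, 0) k - of_int \<gamma> * l k)\<^sup>2) =
      (\<Sum>k<d. (p' (i, 0) k - p' (j, 0) k - of_int \<gamma> * l' k)\<^sup>2)"
  shows "equivalent_frameworks G n l p d l' p'"
  unfolding equivalent_frameworks_def
proof (intro conjI allI impI)
  fix u v
  assume "{u, v} \<in> lift_edges G"
  then obtain i j \<alpha> \<gamma> where e: "(i, j, \<alpha>) \<in> edges G" "{u, v} = {(i, \<gamma>), (j, \<gamma> + \<alpha>)}"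
    unfolding lift_edges_def by blast
  have ij: "i \<in> verts G" "j \<in> verts G" using e(1) zlabelledD[OF G] by auto
  have 1: "L2_set (\<lambda>k. q (i, \<gamma>) k - q (j, \<gamma> + \<alpha>) k) {..<m} =
      sqrt (\<Sum>k<m. (q (i, 0) k - q (j, 0) k - of_int \<alpha> * h k)\<^sup>2)"
    if "periodic_framework G m h q" for m h q
    unfolding L2_set_def framework_position[OF that ij(1), of \<gamma>]
      framework_position[OF that ij(2), of "\<gamma> + \<alpha>"]
    by (simp add: algebra_simps)
  have 2: "L2_set (\<lambda>k. q x k - q y k) A = L2_set (\<lambda>k. q y k - q x k) A" for q :: "'a \<times> int \<Rightarrow> nat \<Rightarrow> real" and x y A
    unfolding L2_set_def by (simp add: power2_commute)
  have "L2_set (\<lambda>k. p (i, \<gamma>) k - p (j, \<gamma> + \<alpha>) k) {..<n} =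
      L2_set (\<lambda>k. p' (i, \<gamma>) k - p' (j, \<gamma> + \<alpha>) k) {..<d}"
    using 1[OF fw(1)] 1[OF fw(2)] eq[OF e(1)] by simp
  moreover have "u = (i, \<gamma>) \<and> v = (j, \<gamma> + \<alpha>) \<or> v = (i, \<gamma>) \<and> u = (j, \<gamma> + \<alpha>)"
    using e(2) by (auto simp: doubleton_eq_iff)
  ultimately show "L2_set (\<lambda>k. p u k - p v k) {..<n} = L2_set (\<lambda>k. p' u k - p' v k) {..<d}"
    using 2[of p u v] 2[of p' u v] by auto
qed (rule len)

lemma equivalent_frameworks_edge:
  assumes G: "zlabelled G"
    and fw: "periodic_framework G n l p" "periodic_framework G d l' p'"
    and eq: "equivalent_frameworks G n l p d l' p'" and e: "(i, j, \<gamma>) \<in> edges G"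
  shows "(\<Sum>k<n. (p (i, 0) k - p (j, 0) k - of_int \<gamma> * l k)\<^sup>2) =
      (\<Sum>k<d. (p' (i, 0) k - p' (j, 0) k - of_int \<gamma> * l' k)\<^sup>2)"
proof -
  have "{(i, 0), (j, 0 + \<gamma>)} \<in> lift_edges G" using e unfolding lift_edges_def by blast
  then have "L2_set (\<lambda>k. p (i, 0) k - p (j, \<gamma>) k) {..<n} = L2_set (\<lambda>k. p' (i, 0) k - p' (j, \<gamma>) k) {..<d}"
    using eq unfolding equivalent_frameworks_def by simp
  then show ?thesis
    using zlabelledD(4)[OF G e] framework_position[OF fw(1), of j \<gamma>] framework_position[OF fw(2), of j \<gamma>]
    unfolding L2_set_def by (simp add: algebra_simps)
qed

text \<open>All lengths are determined by the Gram matrix of the lattice vector and the orbit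
  representatives, and the number of these vectors bounds the dimension. This ensures that the
  minimum in \<open>rd\<close> is attained. In \<open>S\<close>, \<open>None\<close> stands for the
  lattice vector.\<close>

lemma realizable_exists:
  assumes "zlabelled G"
  shows "\<exists>d. realizable d G"
proof -
  define S where "S = insert None (Some ` verts G)"
  have "finite S" using zlabelledD(1)[OF assms] by (simp add: S_def)
  have "\<exists>l' p'. periodic_framework G (card S) l' p' \<and> equivalent_frameworks G n l p (card S) l' p'"
    if fw: "periodic_framework G n l p" for n l p
  proof -
    define v where "v = (\<lambda>x. case x of None \<Rightarrow> l | Some i \<Rightarrow> p (i, 0))"
    obtain w where w: "\<And>x k. x \<in> S \<Longrightarrow> k \<ge> card S \<Longrightarrow> w x k = 0"
      "\<And>x y. x \<in> S \<Longrightarrow> y \<in> S \<Longrightarrow> (\<Sum>k<card S. w x k * w y k) = (\<Sum>k<n. v x k * v y k)"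
      using gram_realization[OF \<open>finite S\<close>, of v n] by blast
    define p' where "p' = (\<lambda>(i, \<gamma>) k. w (Some i) k + of_int \<gamma> * w None k)"
    have l2: "(\<Sum>k<card S. (w None k)\<^sup>2) = (\<Sum>k<n. (l k)\<^sup>2)"
      using w(2)[of None None] by (simp add: S_def v_def power2_eq_square)
    have l: "l \<noteq> (\<lambda>_. 0)" "\<forall>k\<ge>n. l k = 0"
      using fw unfolding periodic_framework_def in_Euclidean by auto
    then obtain k where "l k \<noteq> 0" "k < n" by (meson ext linorder_not_le)
    then have "(\<Sum>k<n. (l k)\<^sup>2) \<noteq> 0" by (auto simp: sum_nonneg_eq_0_iff)
    then have "w None \<noteq> (\<lambda>_. 0)" using l2 by auto
    then have fw': "periodic_framework G (card S) (w None) p'"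
      unfolding periodic_framework_def in_Euclidean lift_verts_def
      using w(1) by (auto simp: p'_def S_def algebra_simps)
    have "equivalent_frameworks G n l p (card S) (w None) p'"
    proof (rule equivalent_frameworksI[OF assms fw fw'])
      show "L2_set l {..<n} = L2_set (w None) {..<card S}" using l2 by (simp add: L2_set_def)
      fix i j \<gamma>
      assume "(i, j, \<gamma>) \<in> edges G"
      then have S: "Some i \<in> S" "Some j \<in> S" "None \<in> S"
        using zlabelledD[OF assms] by (auto simp: S_def)
      have expand: "(\<Sum>k<m. (a k - b k - of_int \<gamma> * c k)\<^sup>2) = (\<Sum>k<m. a k * a k) +
          (\<Sum>k<m. b k * b k) + (of_int \<gamma>)\<^sup>2 * (\<Sum>k<m. c k * c k) - 2 * (\<Sum>k<m. a k * b k)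
          - 2 * of_int \<gamma> * (\<Sum>k<m. a k * c k) + 2 * of_int \<gamma> * (\<Sum>k<m. b k * c k)"
        for m and a b c :: "nat \<Rightarrow> real"
        unfolding sum_distrib_left sum_subtractf[symmetric] sum.distrib[symmetric]
        by (rule sum.cong) (simp_all add: power2_eq_square algebra_simps)
      have v: "p (i, 0) = v (Some i)" "p (j, 0) = v (Some j)" "l = v None"
        by (simp_all add: v_def)
      have p': "p' (i, 0) = w (Some i)" "p' (j, 0) = w (Some j)" by (simp_all add: p'_def)
      show "(\<Sum>k<n. (p (i, 0) k - p (j, 0) k - of_int \<gamma> * l k)\<^sup>2) =
          (\<Sum>k<card S. (p' (i, 0) k - p' (j, 0) k - of_int \<gamma> * w None k)\<^sup>2)"
        unfolding p' v expand using S by (simp add: w(2))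
    qed
    with fw' show ?thesis by blast
  qed
  then show ?thesis unfolding realizable_def by blast
qed

text \<open>A framework remains one when further zero coordinates are counted. This turns
  \<open>rd G \<le> 2\<close>, where the least dimension may be smaller, into
  \<open>realizable 2 G\<close>.\<close>

lemma realizable_mono:
  assumes "zlabelled G" "realizable d G" "d \<le> d'"
  shows "realizable d' G"
  unfolding realizable_def
proof (intro allI impI)
  fix n l p
  assume fw: "periodic_framework G n l p"
  then obtain l' p' where *: "periodic_framework G d l' p'" "equivalent_frameworks G n l p d l' p'"
    using assms(2) unfolding realizable_def by blast
  have ext: "(\<Sum>k<d'. (x k)\<^sup>2) = (\<Sum>k<d. (x k)\<^sup>2)" if "\<forall>k\<ge>d. x k = 0" for x :: "nat \<Rightarrow> real"
    by (rule sum.mono_neutral_right) (use assms(3) that in auto)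
  have l': "\<forall>k\<ge>d. l' k = 0" and p': "\<And>i. i \<in> verts G \<Longrightarrow> \<forall>k\<ge>d. p' (i, 0) k = 0"
    using *(1) unfolding periodic_framework_def in_Euclidean lift_verts_def by auto
  have fw': "periodic_framework G d' l' p'"
    using *(1) assms(3) unfolding periodic_framework_def in_Euclidean by auto
  have "equivalent_frameworks G n l p d' l' p'"
  proof (rule equivalent_frameworksI[OF assms(1) fw fw'])
    show "L2_set l {..<n} = L2_set l' {..<d'}"
      using *(2) ext[OF l'] by (simp add: equivalent_frameworks_def L2_set_def)
    fix i j \<gamma>
    assume e: "(i, j, \<gamma>) \<in> edges G"
    show "(\<Sum>k<n. (p (i, 0) k - p (j, 0) k - of_int \<gamma> * l k)\<^sup>2) =
      (\<Sum>k<d'. (p' (i, 0) k - p' (j, 0) k - of_int \<gamma> * l' k)\<^sup>2)"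
      unfolding equivalent_frameworks_edge[OF assms(1) fw * e]
      by (rule ext[symmetric]) (use l' p' zlabelledD(3,4)[OF assms(1) e] in auto)
  qed
  with fw' show "\<exists>l' p'. periodic_framework G d' l' p' \<and> equivalent_frameworks G n l p d' l' p'"
    by blast
qed

lemma realizable_2_imp_planar:
  assumes G: "zlabelled G" and "realizable 2 G"
  shows "planar G"
proof (rule planarI)
  fix n :: nat and l :: "nat \<Rightarrow> real" and q :: "'a \<Rightarrow> nat \<Rightarrow> real"
  assume pos: "(\<Sum>k<n. (l k)\<^sup>2) > 0"
  \<comment> \<open>In \<open>planar\<close> the values from coordinate \<open>n\<close> on are
    arbitrary, while a framework requires zeros there; hence the truncation.\<close>
  define h where "h = (\<lambda>k. if k < n then l k else 0)"
  define p where "p = (\<lambda>(i, \<gamma>) k. if k < n then q i k + of_int \<gamma> * l k else 0)"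
  have h2: "(\<Sum>k<n. (h k)\<^sup>2) = (\<Sum>k<n. (l k)\<^sup>2)" by (simp add: h_def)
  with pos have "h \<noteq> (\<lambda>_. 0)" by auto
  then have fw: "periodic_framework G n h p"
    unfolding periodic_framework_def in_Euclidean
    by (auto simp: h_def p_def algebra_simps fun_eq_iff)
  then obtain l' p' where *: "periodic_framework G 2 l' p'" "equivalent_frameworks G n h p 2 l' p'"
    using assms(2) unfolding realizable_def by blast
  define c where "c = (\<lambda>x :: nat \<Rightarrow> real. Complex (x 0) (x 1))"
  have c2: "(cmod (c x))\<^sup>2 = (\<Sum>k<2. (x k)\<^sup>2)" for x
    unfolding cmod_power2 by (simp add: c_def numeral_2_eq_2)
  define L where "L = sqrt (\<Sum>k<n. (l k)\<^sup>2)"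
  have "L > 0" using pos by (simp add: L_def)
  have "L = sqrt (\<Sum>k<2. (l' k)\<^sup>2)"
    using *(2) h2 by (simp add: L_def equivalent_frameworks_def L2_set_def)
  then have cl: "cmod (c l') = L" using c2[of l'] by (metis norm_ge_zero real_sqrt_unique)
  \<comment> \<open>The unit number that rotates the lattice vector onto the positive real
    axis.\<close>
  define \<rho> where "\<rho> = of_real L / c l'"
  have "c l' \<noteq> 0" using cl \<open>L > 0\<close> by auto
  then have rho: "cmod \<rho> = 1" "\<rho> * c l' = of_real L"
    using cl \<open>L > 0\<close> by (simp_all add: \<rho>_def norm_divide)
  have "same_length n l q (\<lambda>i. \<rho> * c (p' (i, 0))) (i, j, \<gamma>)" if e: "(i, j, \<gamma>) \<in> edges G" for i j \<gamma>
  proof -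
    have "\<rho> * c (p' (i, 0)) - \<rho> * c (p' (j, 0)) - of_real (of_int \<gamma> * L) =
        \<rho> * c (\<lambda>k. p' (i, 0) k - p' (j, 0) k - of_int \<gamma> * l' k)"
    proof -
      have "c (\<lambda>k. p' (i, 0) k - p' (j, 0) k - of_int \<gamma> * l' k) =
          c (p' (i, 0)) - c (p' (j, 0)) - of_int \<gamma> * c l'"
        by (simp add: c_def complex_eq_iff)
      then show ?thesis
        unfolding of_real_mult rho(2)[symmetric] by (simp only:) (simp add: algebra_simps)
    qed
    then have "(cmod (\<rho> * c (p' (i, 0)) - \<rho> * c (p' (j, 0)) - of_real (of_int \<gamma> * L)))\<^sup>2 =
        (\<Sum>k<2. (p' (i, 0) k - p' (j, 0) k - of_int \<gamma> * l' k)\<^sup>2)"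
      by (simp only: norm_mult rho(1) mult_1 c2)
    also have "\<dots> = (\<Sum>k<n. (p (i, 0) k - p (j, 0) k - of_int \<gamma> * h k)\<^sup>2)"
      using equivalent_frameworks_edge[OF G fw * e] by simp
    also have "\<dots> = (\<Sum>k<n. (q i k - q j k - of_int \<gamma> * l k)\<^sup>2)"
      by (rule sum.cong) (simp_all add: p_def h_def)
    finally show ?thesis by (simp add: same_length_def L_def)
  qed
  then show "\<exists>q'. \<forall>i j \<gamma>. (i, j, \<gamma>) \<in> edges G \<longrightarrow> same_length n l q q' (i, j, \<gamma>)"
    by (intro exI[of _ "\<lambda>i. \<rho> * c (p' (i, 0))"]) blast
qed

lemma planar_imp_realizable_2:
  assumes G: "zlabelled G" and "planar G"
  shows "realizable 2 G"
  unfolding realizable_def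
proof (intro allI impI)
  fix n l p
  assume fw: "periodic_framework G n l p"
  have "l \<noteq> (\<lambda>_. 0)" "\<forall>k\<ge>n. l k = 0"
    using fw unfolding periodic_framework_def in_Euclidean by auto
  then obtain k where "l k \<noteq> 0" "k < n" by (meson ext linorder_not_le)
  then have "(\<Sum>k<n. (l k)\<^sup>2) \<noteq> 0" by (auto simp: sum_nonneg_eq_0_iff)
  then have pos: "(\<Sum>k<n. (l k)\<^sup>2) > 0" by (simp add: sum_nonneg less_le)
  define L where "L = sqrt (\<Sum>k<n. (l k)\<^sup>2)"
  have "L > 0" using pos by (simp add: L_def)
  obtain q' where q': "\<And>i j \<gamma>. (i, j, \<gamma>) \<in> edges G \<Longrightarrow>
      same_length n l (\<lambda>i. p (i, 0)) q' (i, j, \<gamma>)"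
    using planarE[OF assms(2) pos] by blast
  define l' :: "nat \<Rightarrow> real" where "l' = (\<lambda>k. if k = 0 then L else 0)"
  define p' where "p' = (\<lambda>(i, \<gamma>) (k :: nat). if k = 0 then Re (q' i) + of_int \<gamma> * L
      else if k = 1 then Im (q' i) else 0)"
  have fw': "periodic_framework G 2 l' p'"
    unfolding periodic_framework_def in_Euclidean using \<open>L > 0\<close>
    by (auto simp: l'_def p'_def algebra_simps fun_eq_iff)
  have "equivalent_frameworks G n l p 2 l' p'"
  proof (rule equivalent_frameworksI[OF G fw fw'])
    show "L2_set l {..<n} = L2_set l' {..<2}"
      using \<open>L > 0\<close> by (simp add: L2_set_def l'_def numeral_2_eq_2 L_def)
    fix i j \<gamma>
    assume "(i, j, \<gamma>) \<in> edges G"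
    from q'[OF this] show "(\<Sum>k<n. (p (i, 0) k - p (j, 0) k - of_int \<gamma> * l k)\<^sup>2) =
      (\<Sum>k<2. (p' (i, 0) k - p' (j, 0) k - of_int \<gamma> * l' k)\<^sup>2)"
      unfolding same_length_def L_def[symmetric] cmod_power2
      by (simp add: p'_def l'_def numeral_2_eq_2)
  qed
  with fw' show "\<exists>l' p'. periodic_framework G 2 l' p' \<and> equivalent_frameworks G n l p 2 l' p'"
    by blast
qed

lemma rd_le_2_iff_planar:
  assumes "zlabelled G"
  shows "rd G \<le> 2 \<longleftrightarrow> planar G"
proof
  assume "rd G \<le> 2"
  moreover have "realizable (rd G) G"
    unfolding rd_def using realizable_exists[OF assms] by (rule LeastI_ex)
  ultimately show "planar G"
    using realizable_mono[OF assms] realizable_2_imp_planar[OF assms] by blast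
next
  assume "planar G"
  then show "rd G \<le> 2"
    unfolding rd_def using planar_imp_realizable_2[OF assms] by (simp add: Least_le)
qed

section \<open>Realizing sums\<close>

text \<open>Two vectors span at most a plane. With \<open>x\<close> laid on the real axis, the real
  part of \<open>w\<close> is the component of \<open>y\<close> along \<open>x\<close>, and the
  imaginary part is the length that remains, which exists by Cauchy-Schwarz.\<close>

lemma planar_pair_exists:
  fixes x y :: "nat \<Rightarrow> real"
  shows "\<exists>w. \<forall>t. (cmod (w - of_real (t * sqrt (\<Sum>k<n. (x k)\<^sup>2))))\<^sup>2 = (\<Sum>k<n. (y k - t * x k)\<^sup>2)"
proof -
  define X Y P where "X = (\<Sum>k<n. (x k)\<^sup>2)" and "Y = (\<Sum>k<n. (y k)\<^sup>2)" and "P = (\<Sum>k<n. x k * y k)"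
  have nn: "X \<ge> 0" "Y \<ge> 0" by (simp_all add: X_def Y_def sum_nonneg)
  have CS: "P\<^sup>2 \<le> X * Y" unfolding P_def X_def Y_def by (rule Cauchy_Schwarz_ineq_sum)
  define s where "s = P / sqrt X"
  \<comment> \<open>For \<open>X = 0\<close> the Cauchy-Schwarz inequality gives
    \<open>P = 0\<close>, which agrees with the value \<open>0\<close> of the division.\<close>
  have s: "s * sqrt X = P" using CS nn by (cases "X = 0") (auto simp: s_def)
  have "s\<^sup>2 \<le> Y"
    using CS nn by (cases "X = 0") (auto simp: s_def power_divide divide_le_eq less_le mult.commute)
  then have Im: "(sqrt (Y - s\<^sup>2))\<^sup>2 = Y - s\<^sup>2" by simp
  have "(cmod (Complex s (sqrt (Y - s\<^sup>2)) - of_real (t * sqrt X)))\<^sup>2 = (\<Sum>k<n. (y k - t * x k)\<^sup>2)" for t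
  proof -
    have "(cmod (Complex s (sqrt (Y - s\<^sup>2)) - of_real (t * sqrt X)))\<^sup>2 = (s - t * sqrt X)\<^sup>2 + (Y - s\<^sup>2)"
      unfolding cmod_power2 by (simp add: Im)
    also have "\<dots> = Y - 2 * t * (s * sqrt X) + t\<^sup>2 * (sqrt X)\<^sup>2"
      by (simp add: power2_eq_square algebra_simps)
    also have "\<dots> = Y - 2 * t * P + t\<^sup>2 * X" using nn s by simp
    also have "\<dots> = (\<Sum>k<n. (y k - t * x k)\<^sup>2)"
      unfolding X_def Y_def P_def sum_distrib_left sum_subtractf[symmetric] sum.distrib[symmetric]
      by (rule sum.cong) (simp_all add: power2_eq_square algebra_simps)
    finally show ?thesis .
  qed
  then show ?thesis unfolding X_def by blast
qed

text \<open>The vector between the two vertices and the lattice vector fit into a plane, and one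
  placement serves all parallel edges, since \<open>t\<close> may be any label. The length of a
  selfloop depends on the lattice vector alone.\<close>

lemma planar_le_2_verts:
  assumes "zlabelled G" "card (verts G) \<le> 2"
  shows "planar G"
proof (rule planarI)
  fix n :: nat and l q
  assume pos: "(\<Sum>k<n. (l k)\<^sup>2) > (0::real)"
  obtain a b where ab: "verts G \<subseteq> {a, b}"
  proof -
    consider "card (verts G) = 0" | "card (verts G) = 1" | "card (verts G) = 2"
      using assms(2) by linarith
    then show thesis
      by cases (use that zlabelledD(1)[OF assms(1)] in \<open>auto simp: card_1_singleton_iff card_2_iff\<close>)
  qed
  obtain w where w: "\<And>t. (cmod (w - of_real (t * sqrt (\<Sum>k<n. (l k)\<^sup>2))))\<^sup>2 =
      (\<Sum>k<n. (q b k - q a k - t * l k)\<^sup>2)"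
    using planar_pair_exists[of l n "\<lambda>k. q b k - q a k"] by blast
  define q' where "q' = (\<lambda>x. if x = a then 0 else w)"
  have loop: "same_length n l q q' (x, x, \<gamma>)" for x \<gamma>
    unfolding same_length_def by (simp add: norm_mult power_mult_distrib sum_distrib_left sum_nonneg)
  have ba: "same_length n l q q' (b, a, \<gamma>)" for \<gamma>
  proof (cases "a = b")
    case False
    then show ?thesis using w[of "of_int \<gamma>"] by (simp add: same_length_def q'_def)
  qed (use loop in simp)
  have "same_length n l q q' (i, j, \<gamma>)" if e: "(i, j, \<gamma>) \<in> edges G" for i j \<gamma>
    using zlabelledD(3,4)[OF assms(1) e] ab loop ba[of \<gamma>]
      iffD1[OF same_length_swap ba[of "- \<gamma>"]] by auto
  then show "\<exists>q'. \<forall>i j \<gamma>. (i, j, \<gamma>) \<in> edges G \<longrightarrow> same_length n l q q' (i, j, \<gamma>)" by blast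
qed

lemma planar_K3:
  assumes "is_K0 3 K"
  shows "planar K"
proof (rule planarI)
  fix n :: nat and l q
  have z: "zlabelled K" and zero: "\<And>i j \<gamma>. (i, j, \<gamma>) \<in> edges K \<Longrightarrow> \<gamma> = 0"
    using assms unfolding is_K0_def by auto
  obtain a b c where V: "verts K = {a, b, c}" and ne: "a \<noteq> b" "a \<noteq> c" "b \<noteq> c"
    using assms unfolding is_K0_def by (auto simp: card_3_iff)
  define S where "S = sqrt (\<Sum>k<n. (q b k - q a k)\<^sup>2)"
  \<comment> \<open>Here the edge from \<open>a\<close> to \<open>b\<close> takes the place of the
    lattice vector: \<open>t = 0\<close> and \<open>t = 1\<close> give the distances from
    \<open>c\<close> to \<open>a\<close> and to \<open>b\<close>.\<close>
  obtain w where w: "\<And>t. (cmod (w - of_real (t * S)))\<^sup>2 =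
      (\<Sum>k<n. (q c k - q a k - t * (q b k - q a k))\<^sup>2)"
    using planar_pair_exists[of "\<lambda>k. q b k - q a k" n "\<lambda>k. q c k - q a k"] unfolding S_def by blast
  define q' where "q' = (\<lambda>x. if x = a then 0 else if x = b then of_real S else w)"
  have S2: "S\<^sup>2 = (\<Sum>k<n. (q b k - q a k)\<^sup>2)" by (simp add: S_def sum_nonneg)
  have 1: "same_length n l q q' (b, a, 0)" "same_length n l q q' (c, a, 0)" "same_length n l q q' (c, b, 0)"
    using S2 w[of 0] w[of 1] ne by (simp_all add: same_length_def q'_def)
  then have 2: "same_length n l q q' (a, b, 0)" "same_length n l q q' (a, c, 0)" "same_length n l q q' (b, c, 0)"
    by (metis same_length_swap neg_equal_zero)+
  have 3: "same_length n l q q' (x, x, 0)" for x by (simp add: same_length_def)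
  have "same_length n l q q' (i, j, \<gamma>)" if e: "(i, j, \<gamma>) \<in> edges K" for i j \<gamma>
    using zlabelledD(3,4)[OF z e] zero[OF e] 1 2 3 unfolding V by auto
  then show "\<exists>q'. \<forall>i j \<gamma>. (i, j, \<gamma>) \<in> edges K \<longrightarrow> same_length n l q q' (i, j, \<gamma>)" by blast
qed

lemma same_length_zero:
  "cmod (q' i - q' j) = cmod (q'' i - q'' j) \<Longrightarrow>
    same_length n l q q' (i, j, 0) \<longleftrightarrow> same_length n l q q'' (i, j, 0)"
  by (simp add: same_length_def)

text \<open>
  The realization of the first graph may be composed with any map \<open>T\<close> that preserves the lengths
  of its edges, and \<open>T\<close> is chosen to match the two realizations on the common vertices.
\<close>

lemma planar_zunion:
  assumes z: "zlabelled G1" "zlabelled G2" and p: "planar G1" "planar G2"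
    and match: "\<And>n l q q1 q2. \<forall>e \<in> edges G1. same_length n l q q1 e \<Longrightarrow>
      \<forall>e \<in> edges G2. same_length n l q q2 e \<Longrightarrow>
      \<exists>T. (\<forall>e \<in> edges G1. same_length n l q (\<lambda>i. T (q1 i)) e) \<and>
          (\<forall>i \<in> verts G1 \<inter> verts G2. T (q1 i) = q2 i)"
  shows "planar (zunion G1 G2)"
proof (rule planarI)
  fix n :: nat and l q
  assume pos: "(\<Sum>k<n. (l k)\<^sup>2) > (0::real)"
  obtain q1 q2 where q12: "\<forall>e \<in> edges G1. same_length n l q q1 e" "\<forall>e \<in> edges G2. same_length n l q q2 e"
    using p pos unfolding planar_def by metis
  obtain T where T: "\<forall>e \<in> edges G1. same_length n l q (\<lambda>i. T (q1 i)) e"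
      "\<forall>i \<in> verts G1 \<inter> verts G2. T (q1 i) = q2 i"
    using match[OF q12] by blast
  define q' where "q' = (\<lambda>i. if i \<in> verts G2 then q2 i else T (q1 i))"
  have "same_length n l q q' (i, j, \<gamma>)" if "(i, j, \<gamma>) \<in> edges G1" for i j \<gamma>
  proof -
    have "same_length n l q (\<lambda>i. T (q1 i)) (i, j, \<gamma>)" using T(1) that by blast
    moreover have "q' i = T (q1 i)" "q' j = T (q1 j)"
      using T(2) zlabelledD(3,4)[OF z(1) that] by (auto simp: q'_def)
    ultimately show ?thesis by (simp add: same_length_def)
  qed
  moreover have "same_length n l q q' (i, j, \<gamma>)" if "(i, j, \<gamma>) \<in> edges G2" for i j \<gamma>
  proof -
    have "same_length n l q q2 (i, j, \<gamma>)" using q12(2) that by blast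
    then show ?thesis using zlabelledD(3,4)[OF z(2) that] by (simp add: q'_def same_length_def)
  qed
  ultimately show "\<exists>q'. \<forall>i j \<gamma>. (i, j, \<gamma>) \<in> edges (zunion G1 G2) \<longrightarrow> same_length n l q q' (i, j, \<gamma>)"
    by (intro exI[of _ q']) (auto simp: zunion_def)
qed

text \<open>A translation preserves all edge vectors, whatever the labels. Inclusion in
  \<open>{v}\<close>, instead of equality, covers disjoint unions as well.\<close>

lemma planar_one_sum:
  assumes "zlabelled G1" "zlabelled G2" "planar G1" "planar G2" "verts G1 \<inter> verts G2 \<subseteq> {v}"
  shows "planar (zunion G1 G2)"
proof (rule planar_zunion[OF assms(1-4)])
  fix n :: nat and l q q1 q2
  assume q1: "\<forall>e \<in> edges G1. same_length n l q q1 e"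
  have "same_length n l q (\<lambda>i. q1 i + (q2 v - q1 v)) e" if "e \<in> edges G1" for e
    using q1 that by (cases e) (auto simp: same_length_def)
  then show "\<exists>T. (\<forall>e \<in> edges G1. same_length n l q (\<lambda>i. T (q1 i)) e) \<and>
      (\<forall>i \<in> verts G1 \<inter> verts G2. T (q1 i) = q2 i)"
    by (intro exI[of _ "\<lambda>x. x + (q2 v - q1 v)"]) (use assms(5) in auto)
qed

text \<open>A rotation changes the position relative to the lattice vector and so may spoil edges
  with nonzero label; the zero labels of the first summand make it admissible. The common edge has
  the same length in both realizations, so a rigid motion can match its ends.\<close>

lemma planar_balanced_2_sum:
  assumes "zlabelled G1" "zlabelled G2" "planar G1" "planar G2"
    and zero: "\<forall>(i, j, \<gamma>) \<in> edges G1. \<gamma> = 0" and K: "is_K0 2 (zinter G1 G2)"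
  shows "planar (zunion G1 G2)"
proof (rule planar_zunion[OF assms(1-4)])
  fix n :: nat and l q q1 q2
  assume q1: "\<forall>e \<in> edges G1. same_length n l q q1 e" and q2: "\<forall>e \<in> edges G2. same_length n l q q2 e"
  obtain a b where ab: "verts G1 \<inter> verts G2 = {a, b}" "a \<noteq> b"
      "(a, b, 0) \<in> edges G1 \<inter> edges G2 \<or> (b, a, 0) \<in> edges G1 \<inter> edges G2"
    using K unfolding is_K0_def zinter_def by (auto simp: card_2_iff)
  obtain i j where ij: "{i, j} = {a, b}" "(i, j, 0) \<in> edges G1" "(i, j, 0) \<in> edges G2"
    using ab(3) by blast
  then have "(cmod (q1 i - q1 j))\<^sup>2 = (cmod (q2 i - q2 j))\<^sup>2"
    using q1 q2 by (fastforce simp: same_length_def)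
  then have eq: "cmod (q1 j - q1 i) = cmod (q2 j - q2 i)" by (simp add: norm_minus_commute)
  \<comment> \<open>If the common edge has length zero, a translation alone matches it.\<close>
  define \<rho> where "\<rho> = (if q1 j = q1 i then 1 else (q2 j - q2 i) / (q1 j - q1 i))"
  have rho: "cmod \<rho> = 1" "\<rho> * (q1 j - q1 i) = q2 j - q2 i"
    using eq by (auto simp: \<rho>_def norm_divide)
  define T where "T = (\<lambda>x. q2 i + \<rho> * (x - q1 i))"
  have "same_length n l q (\<lambda>i. T (q1 i)) e" if e: "e \<in> edges G1" for e
  proof -
    obtain c d \<gamma> where cd: "e = (c, d, \<gamma>)" by (cases e)
    then have [simp]: "\<gamma> = 0" using zero e by auto
    have "T (q1 c) - T (q1 d) = \<rho> * (q1 c - q1 d)" by (simp add: T_def algebra_simps)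
    then have "cmod (T (q1 c) - T (q1 d)) = cmod (q1 c - q1 d)" by (simp add: norm_mult rho)
    then show ?thesis using q1 e cd same_length_zero[of "\<lambda>i. T (q1 i)" c d q1] by auto
  qed
  moreover have "T (q1 i) = q2 i" "T (q1 j) = q2 j" using rho by (simp_all add: T_def)
  ultimately show "\<exists>T. (\<forall>e \<in> edges G1. same_length n l q (\<lambda>i. T (q1 i)) e) \<and>
      (\<forall>i \<in> verts G1 \<inter> verts G2. T (q1 i) = q2 i)"
    using ab(1) ij(1) by (intro exI[of _ T]) (auto simp: doubleton_eq_iff)
qed

lemma sum_of_F_planar:
  assumes "sum_of_F G"
  shows "zlabelled G \<and> planar G"
  using assms
proof (induction)
  case (base G)
  then obtain K :: "nat zgraph" where "zlabelled G" "zlabelled K" "isomorphic G K"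
      "is_K0 3 K \<or> card (verts K) \<le> 2"
    unfolding in_F_def by blast
  then show ?case using planar_isomorphic planar_K3 planar_le_2_verts by blast
next
  case (iso G H)
  then show ?case using planar_isomorphic zlabelled_isomorphic by blast
next
  case (disjoint G1 G2 G)
  then show ?case
    using planar_one_sum[of G1 G2] unfolding disjoint_union_def is_union_def by auto
next
  case (one G1 G2 G)
  then show ?case
    using planar_one_sum[of G1 G2] unfolding one_sum_def is_union_def by auto
next
  case (balanced G1 G2 G)
  then show ?case
    using planar_balanced_2_sum[of G1 G2] unfolding balanced_sum_def is_union_def by auto
qed

lemma sub_sum_of_F_planar:
  assumes "sum_of_F H" "subgraph_of G H"
  shows "planar G"
proof -
  obtain H' where H': "deletion\<^sup>*\<^sup>* H H'" "isomorphic H' G"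
    using assms(2) unfolding subgraph_of_def by blast
  from H'(1) have "zlabelled H' \<and> planar H'"
  proof (induction)
    case (step A B)
    then show ?case
      using zlabelled_deletion[of A B] edges_deletion[of A B] planar_subset[of A B] by blast
  qed (rule sum_of_F_planar[OF assms(1)])
  then show ?thesis using planar_isomorphic[OF H'(2)] by simp
qed

section \<open>The forbidden minors\<close>

definition bad :: "'v zgraph \<Rightarrow> bool" where
  "bad G \<longleftrightarrow> (\<exists>K :: nat zgraph. (is_K0 4 K \<or> is_K3dd K) \<and> minor_of K G)"

definition adj :: "'v zgraph \<Rightarrow> 'v \<Rightarrow> 'v \<Rightarrow> bool" where
  "adj G x y \<longleftrightarrow> x \<noteq> y \<and> (\<exists>\<alpha>. (x, y, \<alpha>) \<in> sym_edges G)"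

definition dbl :: "'v zgraph \<Rightarrow> 'v \<Rightarrow> 'v \<Rightarrow> bool" where
  "dbl G x y \<longleftrightarrow> x \<noteq> y \<and> (\<exists>\<alpha> \<beta>. \<alpha> \<noteq> \<beta> \<and> (x, y, \<alpha>) \<in> sym_edges G \<and> (x, y, \<beta>) \<in> sym_edges G)"

definition nbrs :: "'v zgraph \<Rightarrow> 'v \<Rightarrow> 'v set" where
  "nbrs G x = {y. adj G x y}"

lemma adj_sym: "adj G x y \<longleftrightarrow> adj G y x"
  unfolding adj_def using sym_edges_swap by metis

lemma dbl_sym: "dbl G x y \<longleftrightarrow> dbl G y x"
  unfolding dbl_def using sym_edges_swap by (metis minus_minus)

lemma dbl_adj: "dbl G x y \<Longrightarrow> adj G x y"
  unfolding dbl_def adj_def by blast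

lemma adj_verts: "zlabelled G \<Longrightarrow> adj G x y \<Longrightarrow> x \<in> verts G \<and> y \<in> verts G"
  unfolding adj_def using sym_edges_verts by metis

lemma finite_nbrs: "zlabelled G \<Longrightarrow> finite (nbrs G x)"
  by (rule finite_subset[of _ "verts G"]) (auto simp: nbrs_def dest: adj_verts zlabelledD)

lemma bad_minor_steps: "minor_step\<^sup>*\<^sup>* G H \<Longrightarrow> bad H \<Longrightarrow> bad G"
  unfolding bad_def minor_of_def by (meson rtranclp_trans)

lemma badI:
  assumes "zlabelled G" "zlabelled H" "verts H \<subseteq> verts G" "edges H \<subseteq> sym_edges G"
    "inj_on f (verts H)" "is_K0 4 (rename f H) \<or> is_K3dd (rename f H)"
  shows "bad G"
  unfolding bad_def minor_of_def using minor_steps_subgraph[OF assms(1-4)]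
    isomorphicI[OF rtranclp.rtrancl_refl assms(5)] assms(6) by blast

lemma bad_double_double:
  assumes G: "zlabelled G" and xy: "adj G x y" and xz: "dbl G x z" and yz: "dbl G y z"
  shows "bad G"
proof -
  obtain a b b' c c' where e: "(x, y, a) \<in> sym_edges G"
      "(x, z, b) \<in> sym_edges G" "(x, z, b') \<in> sym_edges G" "b \<noteq> b'"
      "(y, z, c) \<in> sym_edges G" "(y, z, c') \<in> sym_edges G" "c \<noteq> c'"
    using xy xz yz unfolding adj_def dbl_def by blast
  have ne: "x \<noteq> y" "x \<noteq> z" "y \<noteq> z" using xy xz yz by (auto simp: adj_def dbl_def)
  define H where "H = \<lparr>verts = {x, y, z},
      edges = {(x, y, a), (x, z, b), (x, z, b'), (y, z, c), (y, z, c')}\<rparr>"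
  define f where "f = (\<lambda>v. if v = x then 1 else if v = y then 2 else 3 :: nat)"
  show ?thesis
  proof (rule badI[of G H f])
    show "zlabelled H" using ne by (auto simp: zlabelled_def H_def)
    show "verts H \<subseteq> verts G" using e sym_edges_verts[OF G] by (auto simp: H_def)
    show "edges H \<subseteq> sym_edges G" using e by (simp add: H_def)
    show "inj_on f (verts H)" using ne by (auto simp: H_def f_def inj_on_def)
    have "rename f H = \<lparr>verts = {1, 2, 3},
        edges = {(1, 2, a), (1, 3, b), (1, 3, b'), (2, 3, c), (2, 3, c')}\<rparr>"
      using ne by (auto simp: rename_def H_def f_def)
    then show "is_K0 4 (rename f H) \<or> is_K3dd (rename f H)"
      using e unfolding is_K3dd_def by blast
  qed (rule G)
qed

text \<open>The label \<open>\<gamma> + \<alpha>\<close> is that of the path from \<open>x\<close>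
  through \<open>y\<close> to \<open>b\<close>. Edges away from \<open>y\<close> survive because
  only selfloops of label \<open>0\<close> are lost, and a simple labelling has none.\<close>

lemma contract_edge:
  assumes G: "zlabelled G" and e: "(x, y, \<gamma>) \<in> sym_edges G" and "x \<noteq> y"
  obtains H where "zlabelled H" "bad H \<Longrightarrow> bad G" "verts H = verts G - {y}"
    "\<And>a b \<alpha>. (a, b, \<alpha>) \<in> sym_edges G \<Longrightarrow> a \<noteq> y \<Longrightarrow> b \<noteq> y \<Longrightarrow> (a, b, \<alpha>) \<in> sym_edges H"
    "\<And>b \<alpha>. (y, b, \<alpha>) \<in> sym_edges G \<Longrightarrow> b \<noteq> x \<Longrightarrow> b \<noteq> y \<Longrightarrow> (x, b, \<gamma> + \<alpha>) \<in> sym_edges H"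
    "\<And>a b. adj H a b \<longleftrightarrow> a \<noteq> b \<and> a \<noteq> y \<and> b \<noteq> y \<and>
       (adj G a b \<or> a = x \<and> adj G y b \<or> b = x \<and> adj G a y)"
proof -
  define f where "f = (\<lambda>a. if a = y then x else a)"
  define \<phi> where "\<phi> = (\<lambda>a. if a = y then \<gamma> else 0)"
  obtain H where H: "zlabelled H" "minor_step\<^sup>*\<^sup>* G H" "verts H = verts G - {y}"
    "sym_edges H = (\<lambda>(a, b, \<alpha>). (if a = y then x else a, if b = y then x else b,
        \<alpha> + (if a = y then \<gamma> else 0) - (if b = y then \<gamma> else 0))) ` sym_edges G - {(a, a, 0) |a. True}"
    by (rule contraction_along[OF assms])
  have H4: "sym_edges H =
      (\<lambda>(a, b, \<alpha>). (f a, f b, \<alpha> + \<phi> a - \<phi> b)) ` sym_edges G - {(a, a, 0) |a. True}"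
    unfolding f_def \<phi>_def by (rule H(4))
  have in_H: "(f a, f b, \<alpha> + \<phi> a - \<phi> b) \<in> sym_edges H"
    if "(a, b, \<alpha>) \<in> sym_edges G" "\<not> (f a = f b \<and> \<alpha> + \<phi> a - \<phi> b = 0)" for a b \<alpha>
    using that unfolding H4 by force
  have "(a, b, \<alpha>) \<in> sym_edges H" if "(a, b, \<alpha>) \<in> sym_edges G" "a \<noteq> y" "b \<noteq> y" for a b \<alpha>
    using in_H[OF that(1)] that(2,3) sym_edges_loop[OF G, of a \<alpha>] that(1) by (auto simp: f_def \<phi>_def)
  moreover have "(x, b, \<gamma> + \<alpha>) \<in> sym_edges H"
    if "(y, b, \<alpha>) \<in> sym_edges G" "b \<noteq> x" "b \<noteq> y" for b \<alpha>
    using in_H[OF that(1)] that(2,3) by (simp add: f_def \<phi>_def add.commute)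
  moreover have "adj H a b \<longleftrightarrow> a \<noteq> b \<and> a \<noteq> y \<and> b \<noteq> y \<and>
       (adj G a b \<or> a = x \<and> adj G y b \<or> b = x \<and> adj G a y)" for a b
  proof -
    have "adj H a b \<longleftrightarrow> a \<noteq> b \<and> (\<exists>c d. f c = a \<and> f d = b \<and> (\<exists>\<alpha>. (c, d, \<alpha>) \<in> sym_edges G))"
      unfolding adj_def H4 by force
    also have "\<dots> \<longleftrightarrow> a \<noteq> b \<and> (\<exists>c d. f c = a \<and> f d = b \<and> adj G c d)"
      unfolding adj_def by metis
    also have "\<dots> \<longleftrightarrow> a \<noteq> b \<and> a \<noteq> y \<and> b \<noteq> y \<and>
       (adj G a b \<or> a = x \<and> adj G y b \<or> b = x \<and> adj G a y)"
      unfolding f_def using \<open>x \<noteq> y\<close> by auto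
    finally show ?thesis .
  qed
  ultimately show thesis using that[of H] H(1,3) bad_minor_steps[OF H(2)] by blast
qed

text \<open>The triangles \<open>x y z\<close> and \<open>x y w\<close> are unbalanced. Contracting
  their common edge turns the other two edges of each into parallel edges with different labels, and
  together with the edge between \<open>z\<close> and \<open>w\<close> these form a
  \<open>K\<^sub>3\<^sup>\<bullet>\<^sup>\<bullet>\<close>.\<close>

lemma bad_unbalanced_pair:
  assumes G: "zlabelled G" and ne: "x \<noteq> y" "x \<noteq> z" "y \<noteq> z" "x \<noteq> w" "y \<noteq> w" and zw: "adj G z w"
    and xy: "(x, y, \<alpha>) \<in> sym_edges G"
    and z: "(y, z, \<beta>) \<in> sym_edges G" "(x, z, \<gamma>) \<in> sym_edges G" "\<gamma> \<noteq> \<alpha> + \<beta>"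
    and w: "(y, w, \<beta>') \<in> sym_edges G" "(x, w, \<gamma>') \<in> sym_edges G" "\<gamma>' \<noteq> \<alpha> + \<beta>'"
  shows "bad G"
proof -
  obtain H where H: "zlabelled H" "bad H \<Longrightarrow> bad G"
    "\<And>a b \<alpha>. (a, b, \<alpha>) \<in> sym_edges G \<Longrightarrow> a \<noteq> y \<Longrightarrow> b \<noteq> y \<Longrightarrow> (a, b, \<alpha>) \<in> sym_edges H"
    "\<And>b \<beta>. (y, b, \<beta>) \<in> sym_edges G \<Longrightarrow> b \<noteq> x \<Longrightarrow> b \<noteq> y \<Longrightarrow> (x, b, \<alpha> + \<beta>) \<in> sym_edges H"
    using contract_edge[OF G xy ne(1)] by metis
  have "adj H z w" using zw H(3) ne unfolding adj_def by metis
  moreover have "dbl H x z" "dbl H x w"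
    using H(3)[OF z(2)] H(4)[OF z(1)] z(3) H(3)[OF w(2)] H(4)[OF w(1)] w(3) ne
    unfolding dbl_def by metis+
  ultimately show ?thesis using bad_double_double[OF H(1), of z w x] H(2) dbl_sym by metis
qed

text \<open>
  The four triangles of a labelled \<open>K\<^sub>4\<close> cannot have exactly one unbalanced member, and two
  unbalanced triangles share an edge, whose contraction yields \<open>K\<^sub>3\<^sup>\<bullet>\<^sup>\<bullet>\<close>.
\<close>

lemma bad_K4:
  assumes G: "zlabelled G"
    and adj: "adj G a b" "adj G a c" "adj G a d" "adj G b c" "adj G b d" "adj G c d"
  shows "bad G"
proof (rule ccontr)
  assume nb: "\<not> bad G"
  have ne: "a \<noteq> b" "a \<noteq> c" "a \<noteq> d" "b \<noteq> c" "b \<noteq> d" "c \<noteq> d" using adj by (auto simp: adj_def)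
  obtain ab ac ad bc bd cd where e:
      "(a, b, ab) \<in> sym_edges G" "(a, c, ac) \<in> sym_edges G" "(a, d, ad) \<in> sym_edges G"
      "(b, c, bc) \<in> sym_edges G" "(b, d, bd) \<in> sym_edges G" "(c, d, cd) \<in> sym_edges G"
    using adj unfolding adj_def by blast
  note r = e[THEN iffD1[OF sym_edges_swap]]
  \<comment> \<open>From here on, each of the six edges is taken once as the common edge of two
    triangles, one of which must be balanced. The reversed edges \<open>r\<close> supply the
    directions.\<close>
  have "ac = ab + bc \<or> ad = ab + bd"
    using bad_unbalanced_pair[OF G _ _ _ _ _ adj(6) e(1) e(4) e(2) _ e(5) e(3)] nb ne by blast
  moreover have "ab = ac + - bc \<or> ad = ac + cd"
    using bad_unbalanced_pair[OF G _ _ _ _ _ adj(5) e(2) r(4) e(1) _ e(6) e(3)] nb ne by blast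
  moreover have "ab = ad + - bd \<or> ac = ad + - cd"
    using bad_unbalanced_pair[OF G _ _ _ _ _ adj(4) e(3) r(5) e(1) _ r(6) e(2)] nb ne by blast
  moreover have "- ab = bc + - ac \<or> bd = bc + cd"
    using bad_unbalanced_pair[OF G _ _ _ _ _ adj(3) e(4) r(2) r(1) _ e(6) e(5)] nb ne by blast
  moreover have "- ab = bd + - ad \<or> bc = bd + - cd"
    using bad_unbalanced_pair[OF G _ _ _ _ _ adj(2) e(5) r(3) r(1) _ r(6) e(4)] nb ne by blast
  moreover have "- ac = cd + - ad \<or> - bc = cd + - bd"
    using bad_unbalanced_pair[OF G _ _ _ _ _ adj(1) e(6) r(3) r(2) _ r(5) r(4)] nb ne by blast
  ultimately have bal: "ac = ab + bc" "ad = ab + bd" "ad = ac + cd" by linarith+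
  then have bal': "ac - ab = bc" "ad - ab = bd" "ad - ac = cd" by simp_all
  \<comment> \<open>The labels of the edges leaving \<open>a\<close> serve as potential; as the
    triangles are balanced, switching by it makes all six labels zero.\<close>
  define \<phi> where "\<phi> = (\<lambda>v. if v = b then ab else if v = c then ac else if v = d then ad else 0)"
  define H where "H = \<lparr>verts = {a, b, c, d},
      edges = {(a, b, 0), (a, c, 0), (a, d, 0), (b, c, 0), (b, d, 0), (c, d, 0 :: int)}\<rparr>"
  define f where "f = (\<lambda>v. if v = a then 0 else if v = b then 1 else if v = c then 2 else 3 :: nat)"
  have "bad (shift \<phi> G)"
  proof (rule badI[of _ H f])
    show zH: "zlabelled H" using ne by (auto simp: zlabelled_def H_def)
    show "verts H \<subseteq> verts (shift \<phi> G)" using e sym_edges_verts[OF G] by (auto simp: H_def)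
    show "edges H \<subseteq> sym_edges (shift \<phi> G)"
      using e ne bal' by (simp add: H_def in_sym_shift \<phi>_def)
    show inj: "inj_on f (verts H)" using ne by (auto simp: H_def f_def inj_on_def)
    have "zlabelled (rename f H)" using zH inj by (rule zlabelled_rename)
    moreover have "rename f H = \<lparr>verts = {0, 1, 2, 3},
        edges = {(0, 1, 0), (0, 2, 0), (0, 3, 0), (1, 2, 0), (1, 3, 0), (2, 3, 0)}\<rparr>"
      using ne by (auto simp: rename_def H_def f_def)
    ultimately show "is_K0 4 (rename f H) \<or> is_K3dd (rename f H)"
      unfolding is_K0_def by auto
  qed (rule zlabelled_shift[OF G])
  then show False
    using bad_minor_steps[OF relabellings_imp_minor_steps[OF relabellings_shift[OF G]]] nb by blast
qed

text \<open>The degree arguments ignore labels and multiplicities and need neighbourhoods only. A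
  vertex other than \<open>x\<close> and \<open>y\<close> loses a neighbour precisely if it was
  adjacent to both.\<close>

lemma contract_adj:
  assumes G: "zlabelled G" and "adj G x y"
  obtains H where "zlabelled H" "bad H \<longrightarrow> bad G" "verts H = verts G - {y}"
    "\<forall>a. a \<noteq> x \<longrightarrow> a \<noteq> y \<longrightarrow>
      nbrs H a = (if y \<in> nbrs G a then insert x (nbrs G a - {y}) else nbrs G a)"
    "nbrs H x = nbrs G x \<union> nbrs G y - {x, y}"
proof -
  obtain \<gamma> where "(x, y, \<gamma>) \<in> sym_edges G" "x \<noteq> y" using assms(2) by (auto simp: adj_def)
  from contract_edge[OF G this] obtain H where H: "zlabelled H" "bad H \<Longrightarrow> bad G"
      "verts H = verts G - {y}" "\<And>a b. adj H a b \<longleftrightarrow> a \<noteq> b \<and> a \<noteq> y \<and> b \<noteq> y \<and>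
       (adj G a b \<or> a = x \<and> adj G y b \<or> b = x \<and> adj G a y)"
    by metis
  have "nbrs H a = (if y \<in> nbrs G a then insert x (nbrs G a - {y}) else nbrs G a)"
    if "a \<noteq> x" "a \<noteq> y" for a
    using that H(4) \<open>x \<noteq> y\<close> by (auto simp: nbrs_def adj_def)
  moreover have "nbrs H x = nbrs G x \<union> nbrs G y - {x, y}"
    using H(4) \<open>x \<noteq> y\<close> by (auto simp: nbrs_def adj_def)
  ultimately show thesis using that H(1-3) by blast
qed

definition induced :: "'v zgraph \<Rightarrow> 'v set \<Rightarrow> 'v zgraph" where
  "induced G A = \<lparr>verts = A, edges = {(i, j, \<gamma>) \<in> edges G. i \<in> A \<and> j \<in> A}\<rparr>"

lemma in_sym_induced:
  "(i, j, \<gamma>) \<in> sym_edges (induced G A) \<longleftrightarrow> (i, j, \<gamma>) \<in> sym_edges G \<and> i \<in> A \<and> j \<in> A"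
  by (auto simp: in_sym_edges induced_def)

lemma verts_induced [simp]: "verts (induced G A) = A"
  by (simp add: induced_def)

lemma zlabelled_induced:
  assumes "zlabelled G" "A \<subseteq> verts G"
  shows "zlabelled (induced G A)"
  using assms unfolding zlabelled_def induced_def
  by (auto intro: finite_subset rev_finite_subset[of "edges G"])

lemma bad_induced:
  assumes "zlabelled G" "A \<subseteq> verts G" "bad (induced G A)"
  shows "bad G"
proof (rule bad_minor_steps[OF minor_steps_subgraph[OF assms(1)] assms(3)])
  show "zlabelled (induced G A)" using assms(1,2) by (rule zlabelled_induced)
qed (use assms(2) in \<open>auto simp: induced_def in_sym_edges\<close>)

section \<open>Vertices with few neighbours\<close>

lemma mem_nbrs: "y \<in> nbrs G x \<longleftrightarrow> adj G x y"
  by (simp add: nbrs_def)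

lemma nbrs_sym: "y \<in> nbrs G x \<longleftrightarrow> x \<in> nbrs G y"
  by (simp add: nbrs_def adj_sym)

lemma nbrs_verts: "zlabelled G \<Longrightarrow> y \<in> nbrs G x \<Longrightarrow> x \<in> verts G \<and> y \<in> verts G"
  by (simp add: nbrs_def adj_verts)

lemma nbrs_irrefl [simp]: "x \<notin> nbrs G x"
  by (simp add: nbrs_def adj_def)

lemma card_swap_elem:
  assumes "finite A" "y \<in> A" "x \<notin> A"
  shows "card (insert x (A - {y})) = card A"
  using assms by (metis Diff_iff card_Suc_Diff1 card_insert_disjoint finite_Diff)

lemma card_3_obtain:
  assumes "card A = 3" "a \<in> A" "b \<in> A" "a \<noteq> b"
  obtains c where "A = {a, b, c}" "c \<noteq> a" "c \<noteq> b"
proof -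
  have "finite A" using assms(1) card.infinite by fastforce
  then have "card (A - {a, b}) = 1" using assms by (simp add: card_Diff_subset)
  then obtain c where "A - {a, b} = {c}" by (auto simp: card_1_singleton_iff)
  then show thesis using that[of c] assms by blast
qed

text \<open>Excludes a minimal counterexample in which \<open>r\<close> has a neighbour besides
  \<open>s\<close>. The contractions keep the edge between \<open>r\<close> and \<open>s\<close>, so
  each contradicts minimality unless a degree drops below three or a forbidden minor appears. This
  reveals a cluster of cubic vertices near \<open>r\<close>, and contracting the whole cluster into
  \<open>r\<close> finally lowers no remaining degree.\<close>

lemma small_degree_avoiding_edge_step:
  assumes G: "zlabelled G" "\<not> bad G"
    and IH: "\<And>H. zlabelled H \<Longrightarrow> \<not> bad H \<Longrightarrow> card (verts H) < card (verts G) \<Longrightarrow> adj H r s \<Longrightarrow>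
      verts H \<noteq> {r, s} \<Longrightarrow> \<exists>v \<in> verts H - {r, s}. card (nbrs H v) \<le> 2"
    and rs: "s \<in> nbrs G r" and y0: "y0 \<in> nbrs G r" "y0 \<noteq> s"
    and deg: "\<And>v. v \<in> verts G - {r, s} \<Longrightarrow> card (nbrs G v) \<ge> 3"
  shows False
proof -
  note fin [simp] = finite_nbrs[OF G(1)]
  note verts = nbrs_verts[OF G(1)]
  have V: "finite (verts G)" using zlabelledD(1)[OF G(1)] .
  have IH': False if "zlabelled H" "bad H \<Longrightarrow> bad G" "verts H \<subset> verts G" "s \<in> nbrs H r"
    "t \<in> verts H - {r, s}" "\<And>v. v \<in> verts H - {r, s} \<Longrightarrow> card (nbrs H v) \<ge> 3" for H t
  proof -
    have "\<exists>v \<in> verts H - {r, s}. card (nbrs H v) \<le> 2"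
      by (rule IH) (use that G(2) psubset_card_mono[OF V that(3)] in \<open>auto simp: mem_nbrs\<close>)
    with that(6) show False by fastforce
  qed
  have "r \<noteq> s" using rs by auto
  \<comment> \<open>Contracting \<open>y\<close> into \<open>r\<close> lowers only the degrees of
    their common neighbours, by one each, so one of these other than \<open>s\<close> must have
    degree exactly three.\<close>
  have cubic: "\<exists>v. v \<in> nbrs G r \<and> v \<in> nbrs G y \<and> v \<noteq> s \<and> card (nbrs G v) = 3"
    if y: "y \<in> nbrs G r" "y \<noteq> s" for y
  proof (rule ccontr)
    assume no: "\<nexists>v. v \<in> nbrs G r \<and> v \<in> nbrs G y \<and> v \<noteq> s \<and> card (nbrs G v) = 3"
    have "r \<noteq> y" using y by auto
    obtain H where H: "zlabelled H" "bad H \<longrightarrow> bad G" "verts H = verts G - {y}"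
      "\<forall>a. a \<noteq> r \<longrightarrow> a \<noteq> y \<longrightarrow>
        nbrs H a = (if y \<in> nbrs G a then insert r (nbrs G a - {y}) else nbrs G a)"
      "nbrs H r = nbrs G r \<union> nbrs G y - {r, y}"
      by (rule contract_adj[OF G(1) y(1)[unfolded mem_nbrs]])
    note H = H[rule_format]
    \<comment> \<open>A neighbour \<open>t\<close> of \<open>y\<close> outside the edge guarantees
      that the contracted graph is more than the edge itself.\<close>
    have "card (nbrs G y) \<ge> 3" using deg[of y] y verts[OF y(1)] \<open>r \<noteq> y\<close> by auto
    moreover have "card {r, s} = 2" using \<open>r \<noteq> s\<close> by simp
    ultimately have "\<not> nbrs G y \<subseteq> {r, s}" using card_mono[of "{r, s}" "nbrs G y"] by fastforce
    then obtain t where t: "t \<in> nbrs G y" "t \<noteq> r" "t \<noteq> s" by blast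
    moreover have "t \<noteq> y" using t(1) nbrs_irrefl by metis
    ultimately have t': "t \<in> verts H - {r, s}" using H(3) verts[OF t(1)] by simp
    have "card (nbrs H v) \<ge> 3" if v: "v \<in> verts H - {r, s}" for v
    proof (cases "y \<in> nbrs G v")
      case False
      then show ?thesis using H(3,4) v deg[of v] by auto
    next
      case True
      then have eq: "nbrs H v = insert r (nbrs G v - {y})" using H(3,4) v by auto
      show ?thesis
      proof (cases "r \<in> nbrs G v")
        case True
        then have "card (nbrs G v) \<noteq> 3"
          using no \<open>y \<in> nbrs G v\<close> v nbrs_sym by fast
        then have "card (nbrs G v) \<ge> 4" using deg[of v] v H(3) by auto
        moreover have "nbrs H v = nbrs G v - {y}" using eq True \<open>r \<noteq> y\<close> by auto
        ultimately show ?thesis using \<open>y \<in> nbrs G v\<close> by simp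
      next
        case False
        then have "card (nbrs H v) = card (nbrs G v)"
          unfolding eq using \<open>y \<in> nbrs G v\<close> by (intro card_swap_elem) auto
        then show ?thesis using deg[of v] v H(3) by auto
      qed
    qed
    moreover have "s \<in> nbrs H r" using H(5) rs y \<open>r \<noteq> s\<close> by auto
    moreover have "verts H \<subset> verts G" using H(3) verts[OF y(1)] by auto
    ultimately show False using IH'[OF H(1,2) _ _ t'] by blast
  qed
  \<comment> \<open>Used for \<open>y0\<close> and then for \<open>v\<close>, the claim gives a
    triangle \<open>r v w\<close> in which \<open>v\<close> and \<open>w\<close> are cubic.\<close>
  obtain v where v: "v \<in> nbrs G r" "v \<noteq> s" "card (nbrs G v) = 3"
    using cubic[OF y0] by blast
  obtain w where w: "w \<in> nbrs G r" "w \<in> nbrs G v" "w \<noteq> s" "card (nbrs G w) = 3"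
    using cubic[OF v(1,2)] by blast
  have ne: "v \<noteq> r" "w \<noteq> r" "v \<noteq> w" using v w by auto
  have sym: "r \<in> nbrs G v" "r \<in> nbrs G w" "v \<in> nbrs G w" using v w nbrs_sym by fast+
  obtain z where Nv: "nbrs G v = {r, w, z}" "z \<noteq> r" "z \<noteq> w"
    by (rule card_3_obtain[OF v(3) sym(1) w(2)]) (use ne in auto)
  obtain z' where Nw: "nbrs G w = {r, v, z'}" "z' \<noteq> r" "z' \<noteq> v"
    by (rule card_3_obtain[OF w(4) sym(2) sym(3)]) (use ne in auto)
  have "z \<noteq> v" using Nv(1) nbrs_irrefl[of v G] by auto
  have "z' \<noteq> w" using Nw(1) nbrs_irrefl[of w G] by auto
  \<comment> \<open>Otherwise contract \<open>w\<close> into \<open>v\<close>: the merged vertex has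
    the three neighbours \<open>r\<close>, \<open>z\<close>, \<open>z'\<close>, and only the exempt
    vertex \<open>r\<close> was adjacent to both.\<close>
  have "z = z'"
  proof (rule ccontr)
    assume "z \<noteq> z'"
    obtain H where H: "zlabelled H" "bad H \<longrightarrow> bad G" "verts H = verts G - {w}"
      "\<forall>a. a \<noteq> v \<longrightarrow> a \<noteq> w \<longrightarrow>
        nbrs H a = (if w \<in> nbrs G a then insert v (nbrs G a - {w}) else nbrs G a)"
      "nbrs H v = nbrs G v \<union> nbrs G w - {v, w}"
      by (rule contract_adj[OF G(1) w(2)[unfolded mem_nbrs]])
    note H = H[rule_format]
    have "nbrs H v = {r, z, z'}" unfolding H(5) Nv(1) Nw(1)
      using Nv(2,3) Nw(2,3) ne \<open>z \<noteq> v\<close> \<open>z' \<noteq> w\<close> by auto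
    then have "card (nbrs H v) = 3" using \<open>z \<noteq> z'\<close> Nv(2) Nw(2) by simp
    moreover have "card (nbrs H u) \<ge> 3" if u: "u \<in> verts H - {r, s}" "u \<noteq> v" for u
    proof (cases "w \<in> nbrs G u")
      case False
      then show ?thesis using H(3,4) u deg[of u] by auto
    next
      case True
      then have "u \<in> nbrs G w" using nbrs_sym by fast
      then have "v \<notin> nbrs G u"
        using Nv Nw u \<open>z \<noteq> z'\<close> H(3) nbrs_sym[of v G u] by auto
      then have "card (nbrs H u) = card (nbrs G u)"
        using H(3,4) u True card_swap_elem[of "nbrs G u" w v] by auto
      then show ?thesis using deg[of u] u H(3) by auto
    qed
    ultimately have "card (nbrs H u) \<ge> 3" if "u \<in> verts H - {r, s}" for u
      using that by (cases "u = v") auto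
    moreover have "v \<in> verts H - {r, s}" using H(3) verts[OF v(1)] ne v by auto
    moreover have "s \<in> nbrs H r" using H(4)[of r] ne rs w by auto
    moreover have "verts H \<subset> verts G" using H(3) verts[OF w(1)] by auto
    ultimately show False using IH'[OF H(1,2)] by blast
  qed
  note Nw = Nw(1)[folded \<open>z = z'\<close>]
  have zN: "v \<in> nbrs G z" "w \<in> nbrs G z" using Nv(1) Nw nbrs_sym[of z G] by auto
  have K4: "z \<notin> nbrs G r"
  proof
    assume "z \<in> nbrs G r"
    then have "bad G"
      using bad_K4[OF G(1), of r v w z] v w Nv Nw by (auto simp: mem_nbrs[symmetric])
    with G(2) show False ..
  qed
  then have "z \<noteq> s" using rs by auto
  have zV: "z \<in> verts G - {r, s}" using verts[OF zN(1)] Nv \<open>z \<noteq> s\<close> by auto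
  \<comment> \<open>Now \<open>v\<close> and then \<open>w\<close> are contracted into
    \<open>r\<close>. Outside the exempt edge only \<open>z\<close> loses degree: it gives up two
    neighbours and gains \<open>r\<close>.\<close>
  obtain H1 where H1: "zlabelled H1" "bad H1 \<longrightarrow> bad G" "verts H1 = verts G - {v}"
    "\<forall>a. a \<noteq> r \<longrightarrow> a \<noteq> v \<longrightarrow>
      nbrs H1 a = (if v \<in> nbrs G a then insert r (nbrs G a - {v}) else nbrs G a)"
    "nbrs H1 r = nbrs G r \<union> nbrs G v - {r, v}"
    by (rule contract_adj[OF G(1) v(1)[unfolded mem_nbrs]])
  note H1 = H1[rule_format]
  have "adj H1 r w" unfolding mem_nbrs[symmetric] H1(5) using w ne by auto
  from contract_adj[OF H1(1) this] obtain H2 where H2: "zlabelled H2" "bad H2 \<longrightarrow> bad H1" "verts H2 = verts H1 - {w}"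
    "\<forall>a. a \<noteq> r \<longrightarrow> a \<noteq> w \<longrightarrow>
      nbrs H2 a = (if w \<in> nbrs H1 a then insert r (nbrs H1 a - {w}) else nbrs H1 a)"
    "nbrs H2 r = nbrs H1 r \<union> nbrs H1 w - {r, w}" .
  note H2 = H2[rule_format]
  have V2: "verts H2 = verts G - {v, w}" using H1(3) H2(3) by auto
  have r2: "nbrs H2 r = (nbrs G r - {v, w}) \<union> {z}"
    unfolding H2(5) H1(5) H1(4)[OF ne(2) ne(3)[symmetric]] Nv(1) Nw
    using Nv(2,3) ne \<open>z \<noteq> v\<close> by auto
  have z2: "nbrs H2 z = insert r (nbrs G z - {v, w})"
    using H2(4)[of z] H1(4)[of z] zN Nv(2,3) \<open>z \<noteq> v\<close> ne by auto
  have u2: "nbrs H2 u = nbrs G u" if "u \<notin> {r, v, w, z}" for u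
  proof -
    have "v \<notin> nbrs G u" "w \<notin> nbrs G u"
      using that nbrs_sym[of u G v] nbrs_sym[of u G w] unfolding Nv(1) Nw by auto
    then show ?thesis using H2(4)[of u] H1(4)[of u] that by auto
  qed
  have s2: "s \<in> nbrs H2 r" using r2 rs v w by auto
  have zcard: "card (nbrs H2 z) = card (nbrs G z) - 1"
  proof -
    have "r \<notin> nbrs G z" using K4 nbrs_sym by fast
    then have "card (nbrs H2 z) = Suc (card (nbrs G z - {v, w}))" unfolding z2 by simp
    also have "\<dots> = Suc (card (nbrs G z) - 2)"
      using zN ne by (simp add: card_Diff_subset)
    finally show ?thesis using deg[OF zV] by simp
  qed
  have z3: "card (nbrs G z) = 3"
  proof (rule ccontr)
    assume "card (nbrs G z) \<noteq> 3"
    then have "card (nbrs H2 z) \<ge> 3" using deg[OF zV] zcard by simp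
    then have "card (nbrs H2 u) \<ge> 3" if "u \<in> verts H2 - {r, s}" for u
      using that u2[of u] V2 deg[of u] by (cases "u = z") auto
    moreover have "z \<in> verts H2 - {r, s}" using V2 zV \<open>z \<noteq> v\<close> Nv by auto
    moreover have "verts H2 \<subset> verts G" using V2 verts[OF w(1)] by auto
    ultimately show False using IH'[of H2 z] H1(2) H2(1,2) s2 by blast
  qed
  obtain u where Nz: "nbrs G z = {v, w, u}" "u \<noteq> v" "u \<noteq> w"
    by (rule card_3_obtain[OF z3 zN]) (use ne in auto)
  have "u \<noteq> z" using Nz(1) nbrs_irrefl[of z G] by auto
  have "u \<noteq> r" using Nz(1) K4 nbrs_sym[of z G r] by auto
  have uN: "z \<in> nbrs G u" using Nz(1) nbrs_sym[of u G z] by auto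
  \<comment> \<open>Otherwise contracting \<open>u\<close> into \<open>z\<close> would make
    \<open>z\<close> adjacent to \<open>r\<close> and complete a \<open>K\<^sub>4\<close> on
    \<open>r\<close>, \<open>v\<close>, \<open>w\<close>, \<open>z\<close>.\<close>
  have "u \<notin> nbrs G r"
  proof
    assume u: "u \<in> nbrs G r"
    have "adj G z u" unfolding mem_nbrs[symmetric] using Nz(1) by simp
    from contract_adj[OF G(1) this] obtain H where H: "zlabelled H" "bad H \<longrightarrow> bad G"
      "verts H = verts G - {u}"
      "\<forall>a. a \<noteq> z \<longrightarrow> a \<noteq> u \<longrightarrow>
        nbrs H a = (if u \<in> nbrs G a then insert z (nbrs G a - {u}) else nbrs G a)"
      "nbrs H z = nbrs G z \<union> nbrs G u - {z, u}" .
    note H = H[rule_format]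
    have Hr: "nbrs H r = insert z (nbrs G r - {u})" using H(4)[of r] u Nv(2) \<open>u \<noteq> r\<close> by simp
    have "u \<notin> nbrs G v" "u \<notin> nbrs G w"
      unfolding Nv(1) Nw using \<open>u \<noteq> r\<close> \<open>u \<noteq> z\<close> Nz(2,3) by auto
    then have Hvw: "nbrs H v = {r, w, z}" "nbrs H w = {r, v, z}"
      using H(4)[of v] H(4)[of w] Nz(2,3) \<open>z \<noteq> v\<close> Nv Nw by auto
    have "v \<in> nbrs H r" "w \<in> nbrs H r" "z \<in> nbrs H r" using Hr v w Nz(2,3) by auto
    then have "bad H"
      using bad_K4[OF H(1), of r v w z] Hvw unfolding mem_nbrs[symmetric] by simp
    then show False using H(2) G(2) by blast
  qed
  then have "u \<noteq> s" using rs by auto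
  have uV: "u \<in> verts G - {r, s}" using verts[OF uN] \<open>u \<noteq> s\<close> \<open>u \<noteq> r\<close> by auto
  \<comment> \<open>Absorbing \<open>z\<close> into \<open>r\<close> as well merely replaces
    \<open>z\<close> by \<open>r\<close> among the neighbours of \<open>u\<close>, so no degree
    outside the exempt edge drops.\<close>
  have "adj H2 r z" unfolding mem_nbrs[symmetric] using r2 by auto
  from contract_adj[OF H2(1) this] obtain H3 where H3: "zlabelled H3" "bad H3 \<longrightarrow> bad H2" "verts H3 = verts H2 - {z}"
    "\<forall>a. a \<noteq> r \<longrightarrow> a \<noteq> z \<longrightarrow>
      nbrs H3 a = (if z \<in> nbrs H2 a then insert r (nbrs H2 a - {z}) else nbrs H2 a)"
    "nbrs H3 r = nbrs H2 r \<union> nbrs H2 z - {r, z}" .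
  note H3 = H3[rule_format]
  have "card (nbrs H3 x) \<ge> 3" if x: "x \<in> verts H3 - {r, s}" for x
  proof -
    have x': "x \<notin> {r, v, w, z}" "x \<in> verts G - {r, s}" using x H3(3) V2 by auto
    show ?thesis
    proof (cases "x = u")
      case True
      have "r \<notin> nbrs G u" using \<open>u \<notin> nbrs G r\<close> nbrs_sym by fast
      then have "card (nbrs H3 u) = card (nbrs G u)"
        using H3(4)[of u] u2[of u] x' True uN card_swap_elem[of "nbrs G u" z r] by auto
      then show ?thesis using deg[of u] uV True by simp
    next
      case False
      then have "z \<notin> nbrs G x" using Nz(1) x' nbrs_sym by fast
      then show ?thesis using H3(4)[of x] u2[of x] x' deg[of x] by auto
    qed
  qed
  moreover have "u \<in> verts H3 - {r, s}" using uV H3(3) V2 Nz \<open>u \<noteq> z\<close> by auto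
  moreover have "s \<in> nbrs H3 r" using H3(5) s2 \<open>z \<noteq> s\<close> \<open>r \<noteq> s\<close> by auto
  moreover have "verts H3 \<subset> verts G" using V2 H3(3) verts[OF w(1)] by auto
  ultimately show False using IH'[of H3 u] H1(2) H2(2) H3(1,2) by blast
qed

text \<open>
  A variant of Dirac's theorem that graphs of minimum degree three contain a subdivision of \<open>K\<^sub>4\<close>:
  the two ends of one edge are exempt from the degree condition.
\<close>

lemma small_degree_avoiding_edge:
  assumes "zlabelled G" "\<not> bad G" "adj G r s" "verts G \<noteq> {r, s}"
  shows "\<exists>v \<in> verts G - {r, s}. card (nbrs G v) \<le> 2"
  using assms
proof (induction "card (verts G)" arbitrary: G r s rule: less_induct)
  case less
  note G = less.prems
  show ?case
  proof (rule ccontr)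
    assume "\<not> ?case"
    then have deg: "card (nbrs G v) \<ge> 3" if "v \<in> verts G - {r, s}" for v
      using that by (metis eval_nat_numeral(3) not_less_eq_eq)
    have V: "finite (verts G)" using zlabelledD(1)[OF G(1)] .
    have rs: "s \<in> nbrs G r" "r \<in> nbrs G s" using G(3) by (auto simp: nbrs_def adj_sym)
    \<comment> \<open>The preceding lemma, used for either end, shows that \<open>r\<close> and
      \<open>s\<close> form a component of their own.\<close>
    have "y = s" if "y \<in> nbrs G r" for y
      by (rule ccontr, rule small_degree_avoiding_edge_step[OF G(1,2) _ rs(1) that])
         (use less.hyps deg in \<open>simp_all\<close>)
    moreover have "y = r" if "y \<in> nbrs G s" for y
      by (rule ccontr, rule small_degree_avoiding_edge_step[OF G(1,2) _ rs(2) that])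
         (use less.hyps deg in \<open>simp_all\<close>)
    ultimately have out: "nbrs G v \<inter> {r, s} = {}" if "v \<notin> {r, s}" for v
      using that nbrs_sym[of _ G v] by blast
    \<comment> \<open>Degrees in the rest are those in \<open>G\<close>, so any edge of the rest can
      be the exempt edge for the induction hypothesis.\<close>
    define H where "H = induced G (verts G - {r, s})"
    have adjH: "adj H a b \<longleftrightarrow> adj G a b" if "a \<notin> {r, s}" for a b
      using that out[OF that] adj_verts[OF G(1), of a b] unfolding H_def adj_def in_sym_induced nbrs_def
      by (auto simp: adj_def dest: sym_edges_verts[OF G(1)])
    have nbrsH: "nbrs H a = nbrs G a" if "a \<notin> {r, s}" for a
      using adjH[OF that] by (auto simp: nbrs_def)
    have rsV: "r \<in> verts G" "s \<in> verts G" using adj_verts[OF G(1,3)] by auto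
    obtain t where t: "t \<in> verts G - {r, s}" using G(4) rsV by blast
    have "nbrs G t \<noteq> {}" using deg[OF t] by auto
    then obtain t' where t': "t' \<in> nbrs G t" by blast
    then have "t' \<notin> {r, s}" using out[of t] t by auto
    have "verts H \<noteq> {t, t'}"
    proof
      assume *: "verts H = {t, t'}"
      have "nbrs G t \<subseteq> {t, t'}"
        using out[of t] t nbrs_verts[OF G(1), of _ t] * unfolding H_def by auto
      then have "card (nbrs G t) \<le> 2" using card_mono[of "{t, t'}" "nbrs G t"]
        by (auto simp: card_insert_if split: if_splits)
      with deg[OF t] show False by simp
    qed
    moreover have "zlabelled H" "\<not> bad H"
      using zlabelled_induced[OF G(1)] bad_induced[OF G(1)] G(2) unfolding H_def by blast+
    moreover have "card (verts H) < card (verts G)"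
      unfolding H_def by (rule psubset_card_mono[OF V]) (use rsV in auto)
    moreover have "adj H t t'" using adjH t t' by (auto simp: nbrs_def)
    ultimately obtain x where "x \<in> verts H - {t, t'}" "card (nbrs H x) \<le> 2"
      using less.hyps by blast
    then show False using deg[of x] nbrsH[of x] unfolding H_def by auto
  qed
qed

text \<open>Connected and without cut vertex, stated through covers: an offending pair
  \<open>A\<close>, \<open>B\<close> directly provides the vertex sets of a disjoint union or a
  \<open>1\<close>-sum.\<close>

definition inseparable :: "'v zgraph \<Rightarrow> bool" where
  "inseparable G \<longleftrightarrow> (\<forall>A B. A \<union> B = verts G \<longrightarrow> card (A \<inter> B) \<le> 1 \<longrightarrow>
     (\<forall>a \<in> A - B. \<forall>b \<in> B - A. \<not> adj G a b) \<longrightarrow> A = verts G \<or> B = verts G)"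

text \<open>With at most one neighbour, \<open>v\<close> would be cut off by it from the remaining
  vertices, and three vertices guarantee that some remain.\<close>

lemma inseparable_two_nbrs:
  assumes "zlabelled G" "inseparable G" "card (verts G) \<ge> 3" "v \<in> verts G"
  shows "card (nbrs G v) \<ge> 2"
proof (rule ccontr)
  assume "\<not> card (nbrs G v) \<ge> 2"
  then have c: "card (nbrs G v) \<le> 1" by simp
  have N: "nbrs G v \<subseteq> verts G - {v}" using nbrs_verts[OF assms(1)] by force
  have "insert v (nbrs G v) = verts G \<or> verts G - {v} = verts G"
  proof (rule assms(2)[unfolded inseparable_def, rule_format])
    show "insert v (nbrs G v) \<union> (verts G - {v}) = verts G" using N assms(4) by blast
    have "insert v (nbrs G v) \<inter> (verts G - {v}) = nbrs G v" using N by blast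
    then show "card (insert v (nbrs G v) \<inter> (verts G - {v})) \<le> 1" using c by simp
    show "\<not> adj G a b" if "a \<in> insert v (nbrs G v) - (verts G - {v})"
      "b \<in> verts G - {v} - insert v (nbrs G v)" for a b
      using that N by (auto simp: mem_nbrs)
  qed
  then have "verts G = insert v (nbrs G v)" using assms(4) by auto
  then have "card (verts G) \<le> Suc (card (nbrs G v))"
    by (simp add: card_insert_if finite_nbrs[OF assms(1)])
  with c assms(3) show False by simp
qed

text \<open>After the contraction \<open>a\<close> and \<open>b\<close> are adjacent, so a
  separation has both on one side. Adding \<open>v\<close> to that side gives a separation of
  \<open>G\<close> of the same order.\<close>

lemma inseparable_contract:
  assumes G: "zlabelled G" "inseparable G" and N: "nbrs G v = {a, b}" "a \<noteq> b" and v: "v \<in> verts G"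
    and H: "verts H = verts G - {v}"
    "\<And>c d. adj H c d \<longleftrightarrow> c \<noteq> d \<and> c \<noteq> v \<and> d \<noteq> v \<and>
       (adj G c d \<or> c = b \<and> adj G v d \<or> d = b \<and> adj G c v)"
  shows "inseparable H"
  unfolding inseparable_def
proof (intro allI impI)
  fix A B
  assume AB: "A \<union> B = verts H" "card (A \<inter> B) \<le> 1" "\<forall>a \<in> A - B. \<forall>b \<in> B - A. \<not> adj H a b"
  have *: "A = verts H \<or> B = verts H"
    if ab: "a \<in> A" "b \<in> A" and AB: "A \<union> B = verts H" "card (A \<inter> B) \<le> 1"
      "\<forall>a \<in> A - B. \<forall>b \<in> B - A. \<not> adj H a b" for A B
  proof -
    have vB: "v \<notin> B" using AB(1) H(1) by auto
    then have "insert v A \<inter> B = A \<inter> B" by auto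
    moreover have "\<not> adj G c d" if "c \<in> insert v A - B" "d \<in> B - insert v A" for c d
    proof
      assume cd: "adj G c d"
      show False
      proof (cases "c = v")
        case True
        then have "d \<in> {a, b}" using cd N(1) by (auto simp: nbrs_def)
        then show False using ab that by auto
      next
        case False
        then have "adj H c d" unfolding H(2) using cd that vB by (auto simp: adj_def)
        then show False using AB(3) that False by auto
      qed
    qed
    ultimately have "insert v A = verts G \<or> B = verts G"
      using G(2)[unfolded inseparable_def, rule_format, of "insert v A" B] AB(1,2) H(1) v by auto
    then show ?thesis
    proof
      assume "insert v A = verts G"
      then have "A = verts H" using H(1) AB(1) by auto
      then show ?thesis ..
    qed (use vB v in auto)
  qed
  have "a \<noteq> v" "b \<noteq> v" using N nbrs_irrefl[of v G] by auto
  have "adj G a v" using N(1) nbrs_sym[of a G v] by (auto simp: nbrs_def)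
  then have ab: "adj H a b" "adj H b a"
    using H(2) N(2) \<open>a \<noteq> v\<close> \<open>b \<noteq> v\<close> adj_sym by metis+
  have "a \<in> verts G" "b \<in> verts G" using nbrs_verts[OF G(1)] N(1) by auto
  then have "a \<in> A \<union> B" "b \<in> A \<union> B" using AB(1) H(1) \<open>a \<noteq> v\<close> \<open>b \<noteq> v\<close> by auto
  then have "a \<in> A \<and> b \<in> A \<or> a \<in> B \<and> b \<in> B" using ab AB(3) by blast
  moreover have "\<forall>a \<in> B - A. \<forall>b \<in> A - B. \<not> adj H a b" using AB(3) adj_sym by metis
  ultimately show "A = verts H \<or> B = verts H"
    using *[of A B] *[of B A] AB by (auto simp: Int_commute Un_commute)
qed

lemma card_le_2_obtain:
  assumes "card A \<le> 2" "card A \<ge> 2"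
  obtains a b where "A = {a, b}" "a \<noteq> b"
  using assms card_2_iff[of A] by auto

text \<open>A vertex outside the first pair with two neighbours is contracted away in such a way
  that both pairs survive, until they lie in a common triangle and \<open>bad_double_double\<close>
  applies. Inseparability prevents the pairs from lying in different blocks.\<close>

lemma bad_two_doubles:
  assumes "zlabelled G" "inseparable G" "dbl G r s" "dbl G c d" "{r, s} \<noteq> {c, d}"
  shows "bad G"
  using assms
proof (induction "card (verts G)" arbitrary: G c d rule: less_induct)
  case less
  note G = less.prems
  show ?case
  proof (rule ccontr)
    assume nb: "\<not> bad G"
    have V: "finite (verts G)" using zlabelledD(1)[OF G(1)] .
    have rs: "adj G r s" "r \<noteq> s" using dbl_adj[OF G(3)] by (auto simp: adj_def)
    have rsV: "r \<in> verts G" "s \<in> verts G" using adj_verts[OF G(1) rs(1)] by auto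
    have cd: "adj G c d" "c \<noteq> d" using dbl_adj[OF G(4)] by (auto simp: adj_def)
    have cdV: "c \<in> verts G" "d \<in> verts G" using adj_verts[OF G(1) cd(1)] by auto
    have "verts G \<noteq> {r, s}" using cdV cd(2) G(5) by auto
    then obtain v where v: "v \<in> verts G - {r, s}" "card (nbrs G v) \<le> 2"
      using small_degree_avoiding_edge[OF G(1) nb rs(1)] by blast
    have "card {r, s, v} \<le> card (verts G)" using V rsV v by (intro card_mono) auto
    then have "card (verts G) \<ge> 3" using rs(2) v by auto
    then have "card (nbrs G v) \<ge> 2" using inseparable_two_nbrs[OF G(1,2)] v by blast
    with v(2) obtain a0 b0 where N0: "nbrs G v = {a0, b0}" "a0 \<noteq> b0" by (rule card_le_2_obtain)
    \<comment> \<open>If \<open>v\<close> is an end of the second pair, \<open>a\<close> is named to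
      be the other end; contracting the edge between \<open>b\<close> and \<open>v\<close> then
      moves the pair to \<open>b\<close>, \<open>a\<close>.\<close>
    obtain a b where N: "nbrs G v = {a, b}" "a \<noteq> b" and vab: "v \<in> {c, d} \<Longrightarrow> dbl G a v"
    proof (cases "v \<in> {c, d}")
      case True
      then obtain x where "dbl G x v" using G(4) dbl_sym[of G c d] by blast
      moreover from this have "x \<in> {a0, b0}"
        using dbl_adj[of G x v] adj_sym[of G x v] unfolding N0(1)[symmetric] nbrs_def by simp
      ultimately show thesis using that[of a0 b0] that[of b0 a0] N0 by auto
    qed (use that[of a0 b0] N0 in auto)
    have vb: "adj G b v" "adj G a v"
      using N(1) nbrs_sym[of a G v] nbrs_sym[of b G v] unfolding mem_nbrs[symmetric] by auto
    have neq: "b \<noteq> v" "a \<noteq> v" using vb by (auto simp: adj_def)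
    obtain \<gamma> where \<gamma>: "(b, v, \<gamma>) \<in> sym_edges G" using vb by (auto simp: adj_def)
    obtain H where H: "zlabelled H" "bad H \<Longrightarrow> bad G" "verts H = verts G - {v}"
      "\<And>a b \<alpha>. (a, b, \<alpha>) \<in> sym_edges G \<Longrightarrow> a \<noteq> v \<Longrightarrow> b \<noteq> v \<Longrightarrow> (a, b, \<alpha>) \<in> sym_edges H"
      "\<And>x \<alpha>. (v, x, \<alpha>) \<in> sym_edges G \<Longrightarrow> x \<noteq> b \<Longrightarrow> x \<noteq> v \<Longrightarrow> (b, x, \<gamma> + \<alpha>) \<in> sym_edges H"
      "\<And>x y. adj H x y \<longleftrightarrow> x \<noteq> y \<and> x \<noteq> v \<and> y \<noteq> v \<and>
         (adj G x y \<or> x = b \<and> adj G v y \<or> y = b \<and> adj G x v)"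
      using contract_edge[OF G(1) \<gamma> neq(1)] by blast
    have ins: "inseparable H"
      by (rule inseparable_contract[OF G(1,2) N _ H(3,6)]) (use v in auto)
    have less: "card (verts H) < card (verts G)"
      unfolding H(3) using v V by (intro psubset_card_mono) auto
    have keep: "dbl H x y" if "dbl G x y" "x \<noteq> v" "y \<noteq> v" for x y
      using that H(4) unfolding dbl_def by blast
    have drs: "dbl H r s" using keep[OF G(3)] v by auto
    show False
    proof (cases "v \<in> {c, d}")
      case False
      then have "bad H" using less.hyps[OF less H(1) ins drs keep[OF G(4)] G(5)] by auto
      with H(2) nb show False by blast
    next
      case True
      then have av: "dbl G v a" using vab dbl_sym[of G a v] by blast
      show False
      \<comment> \<open>Here the moved pair might coincide with the first one; in that case the
        triangle on \<open>v\<close>, \<open>a\<close>, \<open>b\<close> is already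
        forbidden.\<close>
      proof (cases "{r, s} = {a, b}")
        case True
        then have "dbl G b a"
          using G(3) dbl_sym[of G r s] by (auto simp: doubleton_eq_iff)
        then have "bad G" using bad_double_double[OF G(1) vb(1) _ av] by blast
        with nb show False ..
      next
        case False
        obtain \<alpha> \<beta> where ab: "\<alpha> \<noteq> \<beta>" "(v, a, \<alpha>) \<in> sym_edges G" "(v, a, \<beta>) \<in> sym_edges G"
          using av unfolding dbl_def by blast
        have "dbl H b a"
          unfolding dbl_def using H(5)[OF ab(2)] H(5)[OF ab(3)] ab(1) N(2) neq
          by (intro conjI exI[of _ "\<gamma> + \<alpha>"] exI[of _ "\<gamma> + \<beta>"]) auto
        moreover have "{r, s} \<noteq> {b, a}" using False by blast
        ultimately have "bad H" using less.hyps[OF less H(1) ins drs] by blast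
        with H(2) nb show False by blast
      qed
    qed
  qed
qed

section \<open>Building the sums\<close>

definition loopless :: "'v zgraph \<Rightarrow> bool" where
  "loopless G \<longleftrightarrow> (\<forall>i \<gamma>. (i, i, \<gamma>) \<notin> edges G)"

lemma isomorphic_refl: "isomorphic G G"
  by (rule isomorphic_relabelling) simp

lemma sum_of_F_small:
  fixes G :: "nat zgraph"
  assumes "zlabelled G" "is_K0 3 G \<or> card (verts G) \<le> 2"
  shows "sum_of_F G"
  by (rule sum_of_F.base) (use assms isomorphic_refl in \<open>auto simp: in_F_def\<close>)

lemma sum_of_F_shift: "sum_of_F G \<Longrightarrow> zlabelled G \<Longrightarrow> sum_of_F (shift \<phi> G)"
  using sum_of_F.iso isomorphic_relabelling relabellings_shift by blast

lemma loopless_shift: "loopless (shift \<phi> G) \<longleftrightarrow> loopless G"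
  by (simp add: loopless_def in_edges_shift)

lemma zlabelled_zunion:
  assumes "zlabelled G" "zlabelled H"
    "\<And>i j \<gamma>. (i, j, \<gamma>) \<in> edges G \<Longrightarrow> (j, i, - \<gamma>) \<notin> edges H"
  shows "zlabelled (zunion G H)"
proof -
  have "(i, j, \<gamma>) \<in> edges H \<Longrightarrow> (j, i, - \<gamma>) \<notin> edges G" for i j \<gamma>
    using assms(3)[of j i "- \<gamma>"] by auto
  then show ?thesis using assms unfolding zlabelled_def zunion_def by auto
qed

lemma sym_edges_zunion: "sym_edges (zunion G H) = sym_edges G \<union> sym_edges H"
  by (auto simp: sym_edges_def zunion_def)

lemma verts_zunion [simp]: "verts (zunion G H) = verts G \<union> verts H"
  by (simp add: zunion_def)

lemma loopless_zunion: "loopless G \<Longrightarrow> loopless H \<Longrightarrow> loopless (zunion G H)"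
  by (simp add: loopless_def zunion_def)

lemma sum_of_F_attach_zero_triangle:
  fixes H :: "nat zgraph"
  assumes H: "sum_of_F H" "zlabelled H" "loopless H"
    and e: "(a, b, 0) \<in> sym_edges H" and v: "v \<notin> verts H"
  obtains U where "sum_of_F U" "zlabelled U" "loopless U" "verts U = insert v (verts H)"
    "sym_edges H \<subseteq> sym_edges U" "(a, v, 0) \<in> sym_edges U" "(v, b, 0) \<in> sym_edges U"
proof -
  have ab: "a \<in> verts H" "b \<in> verts H" using sym_edges_verts[OF H(2) e] by auto
  have ne: "a \<noteq> b" "a \<noteq> v" "b \<noteq> v" using sym_edges_loop[OF H(2)] e ab v by auto
  \<comment> \<open>The triangle takes over the orientation that the edge has in \<open>H\<close>;
    otherwise the intersection would contain no edge.\<close>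
  obtain i j where ij: "(i, j, 0) \<in> edges H" "{i, j} = {a, b}"
    using e by (auto simp: in_sym_edges)
  define T where "T = \<lparr>verts = {a, b, v}, edges = {(i, j, 0), (a, v, 0), (v, b, 0 :: int)}\<rparr>"
  have ij': "i = a \<and> j = b \<or> i = b \<and> j = a" using ij(2) by (auto simp: doubleton_eq_iff)
  have zT: "zlabelled T" using ij' ne by (auto simp: zlabelled_def T_def)
  have "is_K0 3 T" unfolding is_K0_def using zT ij' ne by (auto simp: T_def)
  then have sT: "sum_of_F T" using sum_of_F_small zT by blast
  have inH: "x \<noteq> v" "y \<noteq> v" if "(x, y, \<gamma>) \<in> edges H" for x y \<gamma>
    using zlabelledD(3,4)[OF H(2) that] v by auto
  have zU: "zlabelled (zunion T H)"
  proof (rule zlabelled_zunion[OF zT H(2)])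
    fix x y \<gamma>
    assume "(x, y, \<gamma>) \<in> edges T"
    then show "(y, x, - \<gamma>) \<notin> edges H"
      using inH[of y x "- \<gamma>"] zlabelledD(5)[OF H(2) ij(1)] by (auto simp: T_def)
  qed
  have inter: "zinter T H = \<lparr>verts = {a, b}, edges = {(i, j, 0)}\<rparr>"
    using ab v ij(1) inH[of a v 0] inH[of v b 0] by (auto simp: zinter_def T_def)
  have "is_K0 2 (zinter T H)"
    unfolding inter is_K0_def zlabelled_def using ij' ne by auto
  then have "balanced_sum 2 (zunion T H) T H"
    unfolding balanced_sum_def is_union_def using zU zT H(2) by (auto simp: T_def)
  then have "sum_of_F (zunion T H)" using sum_of_F.balanced sT H(1) by blast
  moreover have "loopless (zunion T H)"
    using ne ij' H(3) by (intro loopless_zunion) (auto simp: loopless_def T_def)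
  moreover have "verts (zunion T H) = insert v (verts H)" using ab by (auto simp: T_def)
  moreover have "(a, v, 0) \<in> sym_edges T" "(v, b, 0) \<in> sym_edges T"
    by (simp_all add: in_sym_edges T_def)
  ultimately show thesis using that[of "zunion T H"] zU by (simp add: sym_edges_zunion)
qed

text \<open>A balanced sum needs a zero-labelled triangle, so the edge from \<open>a\<close> to
  \<open>b\<close> is switched to label \<open>0\<close> and the switching undone afterwards. The
  potential of the new vertex is free and yields any \<open>\<alpha>\<close>; the sum of the two new
  labels stays \<open>g\<close>.\<close>

lemma sum_of_F_attach_triangle:
  fixes H :: "nat zgraph"
  assumes H: "sum_of_F H" "zlabelled H" "loopless H"
    and e: "(a, b, g) \<in> sym_edges H" and v: "v \<notin> verts H"
  obtains U where "sum_of_F U" "zlabelled U" "loopless U" "verts U = insert v (verts H)"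
    "sym_edges H \<subseteq> sym_edges U" "(a, v, \<alpha>) \<in> sym_edges U" "(v, b, g - \<alpha>) \<in> sym_edges U"
proof -
  define \<phi> where "\<phi> = (\<lambda>x. if x = b then g else 0)"
  have ab: "a \<in> verts H" "b \<in> verts H" using sym_edges_verts[OF H(2) e] by auto
  have "a \<noteq> b" using H(3) e by (auto simp: in_sym_edges loopless_def)
  then have "(a, b, 0) \<in> sym_edges (shift \<phi> H)" using e by (simp add: in_sym_shift \<phi>_def)
  then obtain U where U: "sum_of_F U" "zlabelled U" "loopless U" "verts U = insert v (verts H)"
    "sym_edges (shift \<phi> H) \<subseteq> sym_edges U" "(a, v, 0) \<in> sym_edges U" "(v, b, 0) \<in> sym_edges U"
    using sum_of_F_attach_zero_triangle[of "shift \<phi> H" a b v] H v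
      sum_of_F_shift zlabelled_shift loopless_shift by (metis verts_shift)
  \<comment> \<open>On the old vertices this undoes \<open>\<phi>\<close>; the value at
    \<open>v\<close> gives the edge from \<open>a\<close> to \<open>v\<close> the label
    \<open>\<alpha>\<close>.\<close>
  define \<psi> where "\<psi> = (\<lambda>x. if x = v then - \<alpha> else - \<phi> x)"
  have sub: "(i, j, \<gamma>) \<in> sym_edges (shift \<psi> U)" if ij: "(i, j, \<gamma>) \<in> sym_edges H" for i j \<gamma>
  proof -
    have "i \<noteq> v" "j \<noteq> v" using sym_edges_verts[OF H(2) ij] v by auto
    moreover have "(i, j, \<gamma> + \<phi> i - \<phi> j) \<in> sym_edges (shift \<phi> H)"
      using ij by (simp add: in_sym_shift)
    ultimately show ?thesis using U(5) by (auto simp: in_sym_shift \<psi>_def)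
  qed
  have "a \<noteq> v" "b \<noteq> v" using ab v by auto
  then have "(a, v, \<alpha>) \<in> sym_edges (shift \<psi> U)" "(v, b, g - \<alpha>) \<in> sym_edges (shift \<psi> U)"
    using U(6,7) \<open>a \<noteq> b\<close> by (simp_all add: in_sym_shift \<psi>_def \<phi>_def)
  moreover have "sym_edges H \<subseteq> sym_edges (shift \<psi> U)" using sub by (metis subsetI prod_cases3)
  ultimately show thesis
    using that[of "shift \<psi> U"] U(4) sum_of_F_shift[OF U(1,2)] zlabelled_shift[OF U(2)]
      iffD2[OF loopless_shift U(3)] by simp
qed

lemma inj_image_Int_le_1:
  assumes "inj_on f V" "A \<subseteq> V" "B \<subseteq> V" "finite V" "card (A \<inter> B) \<le> 1"
  shows "f ` A \<inter> f ` B = {} \<or> (\<exists>c. f ` A \<inter> f ` B = {c})"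
proof -
  have "f ` A \<inter> f ` B = f ` (A \<inter> B)" using assms by (simp add: inj_on_image_Int)
  moreover have "A \<inter> B = {} \<or> (\<exists>c. A \<inter> B = {c})"
    using assms(2-5) by (metis One_nat_def card_0_eq card_1_singletonE finite_Int finite_subset
        le_Suc_eq le_zero_eq)
  ultimately show ?thesis by auto
qed

text \<open>Requiring exactly the vertices of \<open>G\<close>, renamed by one fixed
  \<open>f\<close>, makes the sums built for two sides of a separation meet only in the common
  vertices, and keeps the name of a contracted vertex free for the new triangle.\<close>

lemma sum_of_F_extension:
  fixes G :: "'v zgraph" and f :: "'v \<Rightarrow> nat"
  assumes "zlabelled G" "\<not> bad G" "inj_on f (verts G)"
  shows "\<exists>H. sum_of_F H \<and> zlabelled H \<and> loopless H \<and> verts H = f ` verts G \<and>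
    (\<forall>i j \<gamma>. (i, j, \<gamma>) \<in> sym_edges G \<longrightarrow> i \<noteq> j \<longrightarrow> (f i, f j, \<gamma>) \<in> sym_edges H)"
  using assms
proof (induction "card (verts G)" arbitrary: G rule: less_induct)
  case less
  note G = less.prems
  have V: "finite (verts G)" using zlabelledD(1)[OF G(1)] .
  consider (small) "card (verts G) \<le> 2" | (sep) "\<not> inseparable G"
    | (insep) "card (verts G) \<ge> 3" "inseparable G"
    by linarith
  then show ?case
  proof cases
    case small
    define G' where "G' = \<lparr>verts = verts G, edges = {(i, j, \<gamma>) \<in> edges G. i \<noteq> j}\<rparr>"
    define H where "H = rename f G'"
    have "zlabelled G'"
      using G(1) unfolding zlabelled_def G'_def by (auto intro: rev_finite_subset[of "edges G"])
    then have zH: "zlabelled H" unfolding H_def using G(3) by (intro zlabelled_rename) (auto simp: G'_def)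
    have VH: "verts H = f ` verts G" by (simp add: H_def rename_def G'_def)
    then have "card (verts H) \<le> 2" using small G(3) by (simp add: card_image)
    then have "sum_of_F H" using sum_of_F_small zH by blast
    moreover have "loopless H"
      using G(3) zlabelledD(3,4)[OF G(1)] by (auto simp: loopless_def H_def rename_def G'_def dest: inj_onD)
    moreover have "(f i, f j, \<gamma>) \<in> sym_edges H" if "(i, j, \<gamma>) \<in> sym_edges G" "i \<noteq> j" for i j \<gamma>
      using that by (force simp: in_sym_edges H_def rename_def G'_def)
    ultimately show ?thesis using zH VH by blast
  next
    case sep
    then obtain A B where AB: "A \<union> B = verts G" "card (A \<inter> B) \<le> 1"
        "\<forall>a \<in> A - B. \<forall>b \<in> B - A. \<not> adj G a b" "A \<noteq> verts G" "B \<noteq> verts G"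
      unfolding inseparable_def by blast
    have sub: "A \<subseteq> verts G" "B \<subseteq> verts G" using AB(1) by auto
    have ext: "\<exists>H. sum_of_F H \<and> zlabelled H \<and> loopless H \<and> verts H = f ` C \<and>
        (\<forall>i j \<gamma>. (i, j, \<gamma>) \<in> sym_edges G \<longrightarrow> i \<in> C \<longrightarrow> j \<in> C \<longrightarrow> i \<noteq> j \<longrightarrow>
          (f i, f j, \<gamma>) \<in> sym_edges H)"
      if C: "C \<subseteq> verts G" "C \<noteq> verts G" for C
    proof -
      have less: "card (verts (induced G C)) < card (verts G)"
        using C V by (simp add: psubset_card_mono psubset_eq)
      have inj: "inj_on f (verts (induced G C))" using inj_on_subset[OF G(3) C(1)] by simp
      have nb: "\<not> bad (induced G C)" using bad_induced[OF G(1) C(1)] G(2) by blast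
      obtain H where "sum_of_F H \<and> zlabelled H \<and> loopless H \<and> verts H = f ` verts (induced G C) \<and>
          (\<forall>i j \<gamma>. (i, j, \<gamma>) \<in> sym_edges (induced G C) \<longrightarrow> i \<noteq> j \<longrightarrow> (f i, f j, \<gamma>) \<in> sym_edges H)"
        using less.hyps[OF less zlabelled_induced[OF G(1) C(1)] nb inj] ..
      then show ?thesis by (intro exI[of _ H]) (simp add: in_sym_induced)
    qed
    obtain H1 where H1: "sum_of_F H1" "zlabelled H1" "loopless H1" "verts H1 = f ` A"
        "\<forall>i j \<gamma>. (i, j, \<gamma>) \<in> sym_edges G \<longrightarrow> i \<in> A \<longrightarrow> j \<in> A \<longrightarrow> i \<noteq> j \<longrightarrow> (f i, f j, \<gamma>) \<in> sym_edges H1"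
      using ext[OF sub(1) AB(4)] by (elim exE conjE) (rule that)
    obtain H2 where H2: "sum_of_F H2" "zlabelled H2" "loopless H2" "verts H2 = f ` B"
        "\<forall>i j \<gamma>. (i, j, \<gamma>) \<in> sym_edges G \<longrightarrow> i \<in> B \<longrightarrow> j \<in> B \<longrightarrow> i \<noteq> j \<longrightarrow> (f i, f j, \<gamma>) \<in> sym_edges H2"
      using ext[OF sub(2) AB(5)] by (elim exE conjE) (rule that)
    have int: "verts H1 \<inter> verts H2 = {} \<or> (\<exists>c. verts H1 \<inter> verts H2 = {c})"
      using inj_image_Int_le_1[OF G(3) sub V AB(2)] H1(4) H2(4) by simp
    \<comment> \<open>A conflicting pair of inverse edges would have both ends among at most one
      common vertex and so be a selfloop.\<close>
    have z: "zlabelled (zunion H1 H2)"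
    proof (rule zlabelled_zunion[OF H1(2) H2(2)])
      fix i j \<gamma>
      assume e: "(i, j, \<gamma>) \<in> edges H1"
      show "(j, i, - \<gamma>) \<notin> edges H2"
      proof
        assume e': "(j, i, - \<gamma>) \<in> edges H2"
        have "{i, j} \<subseteq> verts H1 \<inter> verts H2"
          using zlabelledD(3,4)[OF H1(2) e] zlabelledD(3,4)[OF H2(2) e'] by auto
        then have "i = j" using int by (elim disjE exE) (simp, metis empty_subsetI insert_subset singletonD)
        then show False using e H1(3) by (simp add: loopless_def)
      qed
    qed
    have "is_union (zunion H1 H2) H1 H2" using z H1(2) H2(2) by (simp add: is_union_def)
    then have "sum_of_F (zunion H1 H2)"
      using int sum_of_F.disjoint[OF H1(1) H2(1)] sum_of_F.one[OF H1(1) H2(1)]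
      unfolding disjoint_union_def one_sum_def by blast
    moreover have "(f i, f j, \<gamma>) \<in> sym_edges (zunion H1 H2)"
      if e: "(i, j, \<gamma>) \<in> sym_edges G" "i \<noteq> j" for i j \<gamma>
    proof -
      have "adj G i j" "adj G j i" using e adj_sym[of G i j] by (auto simp: adj_def)
      moreover have "i \<in> A \<union> B" "j \<in> A \<union> B" using sym_edges_verts[OF G(1) e(1)] AB(1) by auto
      ultimately have "i \<in> A \<and> j \<in> A \<or> i \<in> B \<and> j \<in> B" using AB(3) by blast
      then show ?thesis using e H1(5) H2(5) by (auto simp: sym_edges_zunion)
    qed
    moreover have "verts (zunion H1 H2) = f ` verts G" using H1(4) H2(4) AB(1) by auto
    ultimately show ?thesis using z loopless_zunion[OF H1(3) H2(3)] by blast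
  next
    case insep
    obtain v0 where "v0 \<in> verts G" using insep(1) by fastforce
    then have "card (nbrs G v0) \<ge> 2" using inseparable_two_nbrs[OF G(1) insep(2,1)] by blast
    then have "nbrs G v0 \<noteq> {}" by auto
    then obtain w0 where "adj G v0 w0" by (auto simp: nbrs_def)
    \<comment> \<open>The exempt edge joins a pair with several edges if there is one; by
      \<open>bad_two_doubles\<close> every other pair is then joined at most once.\<close>
    then obtain r s where rs: "adj G r s" "(\<exists>c d. dbl G c d) \<Longrightarrow> dbl G r s"
      using dbl_adj by metis
    have "card {r, s} \<le> 2" by (simp add: card_insert_if)
    then have "verts G \<noteq> {r, s}" using insep(1) by auto
    then obtain v where v: "v \<in> verts G - {r, s}" "card (nbrs G v) \<le> 2"
      using small_degree_avoiding_edge[OF G(1,2) rs(1)] by blast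
    have "card (nbrs G v) \<ge> 2" using inseparable_two_nbrs[OF G(1) insep(2,1)] v by blast
    with v(2) obtain a b where N: "nbrs G v = {a, b}" "a \<noteq> b" by (rule card_le_2_obtain)
    have single: "\<not> dbl G v x" for x
    proof
      assume d: "dbl G v x"
      then have "{r, s} \<noteq> {v, x}" using v by auto
      then have "bad G" using bad_two_doubles[OF G(1) insep(2) _ d] rs(2) d by blast
      with G(2) show False ..
    qed
    have "adj G v a" "adj G v b" using N(1) by (auto simp: nbrs_def)
    then obtain \<alpha> \<beta> where \<alpha>: "(v, a, \<alpha>) \<in> sym_edges G" and \<beta>: "(v, b, \<beta>) \<in> sym_edges G"
      and ne: "v \<noteq> a" "v \<noteq> b" by (auto simp: adj_def)
    have e: "(b, v, - \<beta>) \<in> sym_edges G" using \<beta> sym_edges_swap by metis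
    \<comment> \<open>The path from \<open>b\<close> through \<open>v\<close> to \<open>a\<close>
      survives as an edge of label \<open>- \<beta> + \<alpha>\<close>. A triangle on it whose first
      edge has label \<open>- \<beta>\<close> restores the two edges at \<open>v\<close>.\<close>
    obtain G' where G': "zlabelled G'" "bad G' \<Longrightarrow> bad G" "verts G' = verts G - {v}"
      "\<And>a b \<alpha>. (a, b, \<alpha>) \<in> sym_edges G \<Longrightarrow> a \<noteq> v \<Longrightarrow> b \<noteq> v \<Longrightarrow> (a, b, \<alpha>) \<in> sym_edges G'"
      "\<And>x \<alpha>. (v, x, \<alpha>) \<in> sym_edges G \<Longrightarrow> x \<noteq> b \<Longrightarrow> x \<noteq> v \<Longrightarrow> (b, x, - \<beta> + \<alpha>) \<in> sym_edges G'"
      using contract_edge[OF G(1) e] ne by metis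
    have less: "card (verts G') < card (verts G)"
      unfolding G'(3) using v V by (intro psubset_card_mono) auto
    have inj: "inj_on f (verts G')" unfolding G'(3) by (rule inj_on_subset[OF G(3)]) auto
    have nb: "\<not> bad G'" using G'(2) G(2) by blast
    obtain H where H: "sum_of_F H" "zlabelled H" "loopless H" "verts H = f ` verts G'"
      "\<forall>i j \<gamma>. (i, j, \<gamma>) \<in> sym_edges G' \<longrightarrow> i \<noteq> j \<longrightarrow> (f i, f j, \<gamma>) \<in> sym_edges H"
      using less.hyps[OF less G'(1) nb inj] by (elim exE conjE) (rule that)
    have "(f b, f a, - \<beta> + \<alpha>) \<in> sym_edges H"
      using G'(5)[OF \<alpha>] H(5) N(2) ne by simp
    moreover have fv: "f v \<notin> verts H"
      using G(3) v G'(3) unfolding H(4) by (auto dest: inj_onD)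
    ultimately obtain U where U: "sum_of_F U" "zlabelled U" "loopless U"
      "verts U = insert (f v) (verts H)" "sym_edges H \<subseteq> sym_edges U"
      "(f b, f v, - \<beta>) \<in> sym_edges U" "(f v, f a, - \<beta> + \<alpha> - - \<beta>) \<in> sym_edges U"
      using sum_of_F_attach_triangle[OF H(1-3), of "f b" "f a" "- \<beta> + \<alpha>" "f v" "- \<beta>"] by metis
    have Uv: "(f v, f x, \<gamma>) \<in> sym_edges U" if "(v, x, \<gamma>) \<in> sym_edges G" "x \<noteq> v" for x \<gamma>
    proof -
      have "x = a \<or> x = b" using that N(1) by (auto simp: nbrs_def adj_def)
      moreover have "\<gamma> = (if x = a then \<alpha> else \<beta>)"
        using single[of x] that \<alpha> \<beta> calculation unfolding dbl_def by metis
      ultimately show ?thesis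
        using U(6,7) sym_edges_swap[of "f b" "f v" "- \<beta>" U] N(2) by auto
    qed
    have "(f i, f j, \<gamma>) \<in> sym_edges U" if ij: "(i, j, \<gamma>) \<in> sym_edges G" "i \<noteq> j" for i j \<gamma>
    proof -
      consider "i = v" | "j = v" | "i \<noteq> v" "j \<noteq> v" by blast
      then show ?thesis
      proof cases
        case 1
        then show ?thesis using Uv ij by auto
      next
        case 2
        then have "(f v, f i, - \<gamma>) \<in> sym_edges U"
          using Uv[of i "- \<gamma>"] ij sym_edges_swap[of i j \<gamma> G] by auto
        then show ?thesis using 2 sym_edges_swap[of "f i" "f v" \<gamma> U] by auto
      next
        case 3
        then show ?thesis using G'(4)[OF ij(1)] H(5) ij(2) U(5) by blast
      qed
    qed
    moreover have "verts U = f ` verts G" using U(4) H(4) G'(3) v by auto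
    ultimately show ?thesis using U(1-3) by blast
  qed
qed

text \<open>All selfloops at one vertex form a one-vertex graph, which belongs to the base class and
  is attached by a \<open>1\<close>-sum; the vertices are treated one after the other.\<close>

lemma sum_of_F_add_loops:
  fixes H :: "nat zgraph"
  assumes H: "sum_of_F H" "zlabelled H" "loopless H"
    and L: "finite L" "\<And>i j \<gamma>. (i, j, \<gamma>) \<in> L \<Longrightarrow> i = j \<and> i \<in> verts H \<and> (j, i, - \<gamma>) \<notin> L"
  shows "sum_of_F \<lparr>verts = verts H, edges = edges H \<union> L\<rparr> \<and>
    zlabelled \<lparr>verts = verts H, edges = edges H \<union> L\<rparr>"
proof -
  have *: "sum_of_F \<lparr>verts = verts H, edges = edges H \<union> {(i, j, \<gamma>) \<in> L. i \<in> S}\<rparr> \<and>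
      zlabelled \<lparr>verts = verts H, edges = edges H \<union> {(i, j, \<gamma>) \<in> L. i \<in> S}\<rparr>"
    if "finite S" "S \<subseteq> verts H" for S
    using that
  proof (induction S)
    case empty
    then show ?case using H by simp
  next
    case (insert v S)
    let ?H = "\<lparr>verts = verts H, edges = edges H \<union> {(i, j, \<gamma>) \<in> L. i \<in> S}\<rparr>"
    let ?L = "\<lparr>verts = {v}, edges = {(i, j, \<gamma>) \<in> L. i = v}\<rparr>"
    have IH: "sum_of_F ?H" "zlabelled ?H" using insert.IH insert.prems by blast+
    have zL: "zlabelled ?L"
      unfolding zlabelled_def using L by (auto intro: rev_finite_subset[of L])
    then have sL: "sum_of_F ?L" by (intro sum_of_F_small) auto
    have "zlabelled (zunion ?H ?L)"
    proof (rule zlabelled_zunion[OF IH(2) zL])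
      fix i j \<gamma>
      assume e: "(i, j, \<gamma>) \<in> edges ?H"
      show "(j, i, - \<gamma>) \<notin> edges ?L"
      proof
        assume "(j, i, - \<gamma>) \<in> edges ?L"
        then have *: "i = v" "j = v" "(j, i, - \<gamma>) \<in> L" using L(2)[of j i "- \<gamma>"] by auto
        then have "(i, j, \<gamma>) \<notin> edges H" using H(3) by (auto simp: loopless_def)
        then show False using e * insert.hyps by auto
      qed
    qed
    moreover have "verts ?H \<inter> verts ?L = {v}" using insert.prems by auto
    ultimately have "sum_of_F (zunion ?H ?L)"
      using sum_of_F.one[OF IH(1) sL] IH(2) zL unfolding one_sum_def is_union_def by blast
    moreover have "zunion ?H ?L =
        \<lparr>verts = verts H, edges = edges H \<union> {(i, j, \<gamma>) \<in> L. i \<in> insert v S}\<rparr>"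
      unfolding zunion_def using insert.prems by auto
    ultimately show ?case using \<open>zlabelled (zunion ?H ?L)\<close> by (simp only:)
  qed
  have "{(i, j, \<gamma>) \<in> L. i \<in> verts H} = L" using L(2) by auto
  with *[of "verts H"] zlabelledD(1)[OF H(2)] show ?thesis by simp
qed

lemma not_bad_imp_sub_sum_of_F:
  fixes G :: "'v zgraph"
  assumes G: "zlabelled G" "\<not> bad G"
  shows "\<exists>H :: nat zgraph. sum_of_F H \<and> subgraph_of G H"
proof -
  obtain f :: "'v \<Rightarrow> nat" where f: "inj_on f (verts G)"
    using finite_imp_inj_to_nat_seg[OF zlabelledD(1)[OF G(1)]] by blast
  define G0 where "G0 = rename f G"
  have zG0: "zlabelled G0" unfolding G0_def using G(1) f by (rule zlabelled_rename)
  have VG0: "verts G0 = f ` verts G" by (simp add: G0_def rename_def)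
  obtain H where H: "sum_of_F H" "zlabelled H" "loopless H" "verts H = f ` verts G"
      "\<forall>i j \<gamma>. (i, j, \<gamma>) \<in> sym_edges G \<longrightarrow> i \<noteq> j \<longrightarrow> (f i, f j, \<gamma>) \<in> sym_edges H"
    using sum_of_F_extension[OF G f] by (elim exE conjE) (rule that)
  define L where "L = {(i, j, \<gamma>) \<in> edges G0. i = j}"
  define H1 where "H1 = \<lparr>verts = verts H, edges = edges H \<union> L\<rparr>"
  have "finite L" unfolding L_def by (rule rev_finite_subset[OF zlabelledD(2)[OF zG0]]) auto
  moreover have "i = j \<and> i \<in> verts H \<and> (j, i, - \<gamma>) \<notin> L" if "(i, j, \<gamma>) \<in> L" for i j \<gamma>
  proof -
    have e: "(i, j, \<gamma>) \<in> edges G0" "i = j" using that by (auto simp: L_def)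
    show ?thesis using e(2) zlabelledD(3,5)[OF zG0 e(1)] H(4) VG0 by (simp add: L_def)
  qed
  ultimately have H1: "sum_of_F H1" "zlabelled H1"
    using sum_of_F_add_loops[OF H(1-3), of L] unfolding H1_def by blast+
  have "edges G0 \<subseteq> sym_edges H1"
  proof
    fix e
    assume e: "e \<in> edges G0"
    then obtain i j \<gamma> where ij: "e = (f i, f j, \<gamma>)" "(i, j, \<gamma>) \<in> edges G"
      by (auto simp: G0_def rename_def)
    show "e \<in> sym_edges H1"
    proof (cases "i = j")
      case True
      then show ?thesis using e ij by (auto simp: in_sym_edges H1_def L_def)
    next
      case False
      then have "(f i, f j, \<gamma>) \<in> sym_edges H" using H(5) ij(2) by (auto simp: in_sym_edges)
      then show ?thesis using ij by (auto simp: in_sym_edges H1_def)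
    qed
  qed
  \<comment> \<open>Deletions act on literal edges, so the sum is reoriented to contain the edges of
    the renamed graph.\<close>
  then obtain H2 where H2: "zlabelled H2" "verts H2 = verts H1" "sym_edges H2 = sym_edges H1"
      "edges G0 \<subseteq> edges H2"
    by (rule reorientation_exists[OF H1(2) _ zlabelledD(5)[OF zG0]])
  have "isomorphic H1 H2"
    by (rule isomorphic_relabelling, rule relabellings_same_sym_edges) (use H1 H2 in auto)
  then have sH2: "sum_of_F H2" using H1(1) sum_of_F.iso by blast
  have del: "deletion\<^sup>*\<^sup>* H2 G0"
    by (rule deletions_subgraph) (use H2 zG0 VG0 H(4) in \<open>auto simp: H1_def\<close>)
  \<comment> \<open>The inverse renaming returns to the original vertex type, as the isomorphism in
    \<open>subgraph_of\<close> permits.\<close>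
  define g where "g = inv_into (verts G) f"
  have g: "g (f x) = x" if "x \<in> verts G" for x using that f by (simp add: g_def)
  have "inj_on g (verts G0)" unfolding VG0 by (rule inj_onI) (use g in auto)
  then have "isomorphic G0 (rename g G0)" by (intro isomorphicI) auto
  moreover have "rename g G0 = G"
  proof -
    have "(\<lambda>x. g (f x)) ` verts G = verts G" using g by auto
    moreover have "(\<lambda>(i, j, \<gamma>). (g (f i), g (f j), \<gamma>)) ` edges G = id ` edges G"
      by (rule image_cong) (use g zlabelledD(3,4)[OF G(1)] in auto)
    ultimately show ?thesis
      unfolding G0_def by (simp add: rename_def image_image case_prod_unfold)
  qed
  ultimately have "subgraph_of G H2" unfolding subgraph_of_def using del by metis
  with sH2 show ?thesis by blast
qed

theorem theorem7p5:
  fixes G :: "'v zgraph"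
  assumes "zlabelled G"
  shows "(rd G \<le> 2 \<longleftrightarrow>
            \<not> (\<exists>K :: nat zgraph. (is_K0 4 K \<or> is_K3dd K) \<and> minor_of K G)) \<and>
         (rd G \<le> 2 \<longleftrightarrow>
            (\<exists>H :: nat zgraph. sum_of_F H \<and> subgraph_of G H))"
proof -
  have "\<not> bad G" if "planar G"
    using that planar_minor[OF _ assms] not_planar_K4 not_planar_K3dd unfolding bad_def by blast
  moreover have "planar G" if "\<exists>H :: nat zgraph. sum_of_F H \<and> subgraph_of G H"
    using that sub_sum_of_F_planar by blast
  ultimately show ?thesis
    using not_bad_imp_sub_sum_of_F[OF assms] rd_le_2_iff_planar[OF assms]
    unfolding bad_def by blast
qed

end
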